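(* Consider the extended stochastic ball model (ESBM) in $\mathbb{R}^m$ with $k$ balls $B^m_{r_i}(c_i)$, probability measures $\mu_i$ and multipliers $\beta_i$, $i\in[k]$, as defined in the context. For every $i\in[k]$, assume that the probability space $(\mu_i,B^m_{r_i}(c_i))$ satisfies (a1), (a2), (a3). For every $i\in[k]$, denote $E_i:=\mathbb{E}\,d(x,c_i)$, where $x$ is a random vector drawn according to $\mu_i$. Assume that there exists some $\gamma\in\mathbb{R}$ that satisfies \[ \max_{i\in[k]}\beta_i(r_i-E_i)<\gamma<\min_{i\in[k]}\beta_i(D_i-E_i). \] For every $i\in[k]$, let $\alpha_i:=E_i+\frac{\gamma}{\beta_i}$ and assume that $c_i$ is the unique point that achieves $\max\{G^\alpha(z)\mid z\in B^m_{r_i}(c_i)\}$. Then (LP) achieves exact recovery with high probability.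
   Context: Notation: $d$ is the Euclidean distance, $\|\cdot\|$ the Euclidean norm, $B^m_r(c)$ the closed ball of radius $r>0$ and center $c$ in $\mathbb{R}^m$, $[k]=\{1,\dots,k\}$, $t_+:=\max\{t,0\}$, and $D_i:=\min\{d(c_i,c_j)-r_i\mid j\in[k],\ j\ne i\}$ (equal to $+\infty$ if $k=1$). ESBM: for every $i\in[k]$, $(\mu_i,B^m_{r_i}(c_i))$ is a probability space (i.e. $\mu_i$ is a Borel probability measure on the ball) and $\beta_i\ge1$ is fixed. For each $i\in[k]$ one draws $n_i:=\beta_i n$ i.i.d. random vectors $x^{(i)}_\ell$, $\ell\in[n_i]$, according to $\mu_i$ (draws from different balls being independent; $n$ is understood to be such that all $\beta_i n$ are integers). Assumptions: (a1) $\mu_i$ is invariant under rotations centered in $c_i$ (for $m=1$: symmetric about $c_i$); (a2) every open subset of $B^m_{r_i}(c_i)$ containing $c_i$ has positive probability measure; (a3) every subset of $B^m_{r_i}(c_i)$ with zero Lebesgue measure has zero probability measure. For $\alpha\in\mathbb{R}^k$ and $z\in\mathbb{R}^m$, $C^\alpha(z):=\sum_{i\in[k]}\sum_{\ell\in[n_i]}(\alpha_i-d(z,x^{(i)}_\ell))_+$ and $G^\alpha(z):=\frac1n\mathbb{E}\,C^\alpha(z)$; explicitly $G^\alpha(z)=\sum_{i\in[k]}\beta_i\int_{B^m_{r_i}(c_i)}(\alpha_i-d(z,x))_+\,d\mu_i(x)$. With $P$ the set of all sampled points, (LP) is \[ \min \sum_{p,q\in P} d(p,q)z_{pq}\ \text{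 s.t. }\ \sum_{p\in P}z_{pq}=1\ \forall q\in P;\ z_{pq}\le y_p\ \forall p,q\in P;\ \sum_{p\in P}y_p=k;\ y_p,z_{pq}\ge0\ \forall p,q\in P, \] and (IP) is the same program with $y_p,z_{pq}\in\{0,1\}$. (LP) achieves exact recovery if it has a unique optimal solution, this solution is also feasible (thus optimal) to (IP), and it assigns each point to the ball from which it is drawn (exactly one point drawn from each ball has $y_p=1$, and $z_{pq}=1$ only if $p,q$ are drawn from the same ball). An event $A_n$ depending on the parameter $n$ happens with high probability if for every $\delta\in(0,1)$ there exists $N>0$ such that $\mathbb{P}(A_n)>1-\delta$ whenever $n>N$.
   Formalization: In dimension m = 1 only, n is restricted to values for which all n_i = β_i n are odd: if some n_i is even, the two middle points of that ball give equal cost, so (LP) almost surely has no unique recovering optimum and the claim fails. *)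

theory Defs
  imports "HOL-Probability.Probability"
begin

section \<open>Assumptions on the probability measure of a ball\<close>

text \<open>For \<open>m \<ge> 2\<close> a rotation is a special orthogonal map. For \<open>m = 1\<close>, where the identity is the
  only such map, the assumption is symmetry about the center.\<close>

definition rotation_invariant :: "(real ^ 'm) measure \<Rightarrow> real ^ 'm \<Rightarrow> bool" where
  "rotation_invariant \<mu> c \<longleftrightarrow>
     (\<forall>Q :: real ^ 'm ^ 'm. rotation_matrix Q \<or> (CARD('m) = 1 \<and> Q = - mat 1)
        \<longrightarrow> distr \<mu> \<mu> (\<lambda>x. c + Q *v (x - c)) = \<mu>)"

definition positive_near_center :: "(real ^ 'm) measure \<Rightarrow> real ^ 'm \<Rightarrow> real \<Rightarrow> bool" where
  "positive_near_center \<mu> c r \<longleftrightarrow>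
     (\<forall>U. openin (top_of_set (cball c r)) U \<and> c \<in> U \<longrightarrow> 0 < measure \<mu> U)"

definition null_on_lebesgue_null :: "(real ^ 'm) measure \<Rightarrow> bool" where
  "null_on_lebesgue_null \<mu> \<longleftrightarrow>
     (\<forall>A \<in> sets \<mu>. A \<in> null_sets lebesgue \<longrightarrow> A \<in> null_sets \<mu>)"

section \<open>The extended stochastic ball model\<close>

text \<open>The balls are indexed by \<open>{1..k}\<close>. The values of \<open>c\<close>, \<open>r\<close>, \<open>\<mu>\<close>, \<open>\<beta>\<close>, \<open>\<alpha>\<close> outside this range
  are irrelevant. The floor is harmless, as \<open>num_draws \<beta> n i\<close> is only used for \<open>n\<close> such that
  \<open>\<beta> i * n\<close> is a natural number.\<close>

definition num_draws :: "(nat \<Rightarrow> real) \<Rightarrow> nat \<Rightarrow> nat \<Rightarrow> nat" where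
  "num_draws \<beta> n i = nat \<lfloor>\<beta> i * real n\<rfloor>"

text \<open>A sample is a family \<open>\<omega>\<close> whose entry \<open>\<omega> (i, l)\<close> is the \<open>l\<close>-th point drawn from the
  \<open>i\<close>-th ball. All entries are independent.\<close>

definition esbm ::
  "nat \<Rightarrow> (nat \<Rightarrow> (real ^ 'm) measure) \<Rightarrow> (nat \<Rightarrow> real) \<Rightarrow> nat \<Rightarrow> (nat \<times> nat \<Rightarrow> real ^ 'm) measure" where
  "esbm k \<mu> \<beta> n = (\<Pi>\<^sub>M p \<in> (SIGMA i:{1..k}. {1..num_draws \<beta> n i}). \<mu> (fst p))"

definition drawn_points ::
  "(nat \<Rightarrow> real) \<Rightarrow> nat \<Rightarrow> (nat \<times> nat \<Rightarrow> real ^ 'm) \<Rightarrow> nat \<Rightarrow> (real ^ 'm) set" where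
  "drawn_points \<beta> n \<omega> i = (\<lambda>l. \<omega> (i, l)) ` {1..num_draws \<beta> n i}"

text \<open>The infimum over the empty set is \<open>\<infinity>\<close>, which is the convention for \<open>k = 1\<close>.\<close>

definition ball_gap :: "nat \<Rightarrow> (nat \<Rightarrow> real ^ 'm) \<Rightarrow> (nat \<Rightarrow> real) \<Rightarrow> nat \<Rightarrow> ereal" where
  "ball_gap k c r i = (INF j \<in> {1..k} - {i}. ereal (dist (c i) (c j) - r i))"

definition contribution ::
  "nat \<Rightarrow> (nat \<Rightarrow> real) \<Rightarrow> nat \<Rightarrow> (nat \<Rightarrow> real) \<Rightarrow> (nat \<times> nat \<Rightarrow> real ^ 'm) \<Rightarrow> real ^ 'm \<Rightarrow> real" where
  "contribution k \<beta> n \<alpha> \<omega> z =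
     (\<Sum>i\<in>{1..k}. \<Sum>l\<in>{1..num_draws \<beta> n i}. max (\<alpha> i - dist z (\<omega> (i, l))) 0)"

definition mean_contribution ::
  "nat \<Rightarrow> (nat \<Rightarrow> (real ^ 'm) measure) \<Rightarrow> (nat \<Rightarrow> real) \<Rightarrow> (nat \<Rightarrow> real) \<Rightarrow> real ^ 'm \<Rightarrow> real" where
  "mean_contribution k \<mu> \<beta> \<alpha> z =
     (\<Sum>i\<in>{1..k}. \<beta> i * (\<integral>x. max (\<alpha> i - dist z x) 0 \<partial>\<mu> i))"

lemma mean_contribution_eq_expectation:
  fixes c :: "nat \<Rightarrow> real ^ 'm"
  assumes prob: "\<And>i. i \<in> {1..k} \<Longrightarrow> prob_space (\<mu> i)"
    and sets: "\<And>i. i \<in> {1..k} \<Longrightarrow> sets (\<mu> i) = sets (restrict_space borel (cball (c i) (r i)))"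
    and n: "0 < n" and nat: "\<And>i. i \<in> {1..k} \<Longrightarrow> \<beta> i * real n \<in> \<nat>"
  shows "mean_contribution k \<mu> \<beta> \<alpha> z =
    (1 / real n) * (\<integral>\<omega>. contribution k \<beta> n \<alpha> \<omega> z \<partial>esbm k \<mu> \<beta> n)"
proof -
  let ?I = "SIGMA i:{1..k}. {1..num_draws \<beta> n i}"
  define \<nu> where "\<nu> p = (if p \<in> ?I then \<mu> (fst p) else return borel 0)" for p :: "nat \<times> nat"
  have esbm: "esbm k \<mu> \<beta> n = PiM ?I \<nu>"
    unfolding esbm_def by (intro PiM_cong) (auto simp: \<nu>_def)
  have prob_\<nu>: "prob_space (\<nu> p)" for p
    by (auto simp: \<nu>_def prob intro!: prob_space_return)
  interpret prob_space "esbm k \<mu> \<beta> n"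
    unfolding esbm by (intro prob_space_PiM prob_\<nu>)
  have meas: "(\<lambda>x. max (\<alpha> i - dist z x) 0) \<in> borel_measurable (\<mu> i)" if "i \<in> {1..k}" for i
  proof -
    have "(\<lambda>x. max (\<alpha> i - dist z x) 0) \<in> borel_measurable (restrict_space borel (cball (c i) (r i)))"
      by (intro measurable_restrict_space1) measurable
    then show ?thesis
      using measurable_cong_sets[OF sets[OF that] refl] by blast
  qed
  have comp: "(\<lambda>\<omega>. \<omega> (i, l)) \<in> measurable (esbm k \<mu> \<beta> n) (\<mu> i)"
    if "i \<in> {1..k}" "l \<in> {1..num_draws \<beta> n i}" for i l
    using measurable_component_singleton[of "(i, l)" ?I "\<lambda>p. \<mu> (fst p)"] that
    unfolding esbm_def by simp
  have distr: "distr (esbm k \<mu> \<beta> n) (\<mu> i) (\<lambda>\<omega>. \<omega> (i, l)) = \<mu> i"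
    if "i \<in> {1..k}" "l \<in> {1..num_draws \<beta> n i}" for i l
    using distr_PiM_component[of ?I \<nu> "(i, l)", OF prob_\<nu>] that
    unfolding esbm by (auto simp: \<nu>_def)
  have exp_eq: "(\<integral>\<omega>. max (\<alpha> i - dist z (\<omega> (i, l))) 0 \<partial>esbm k \<mu> \<beta> n)
      = (\<integral>x. max (\<alpha> i - dist z x) 0 \<partial>\<mu> i)"
    if "i \<in> {1..k}" "l \<in> {1..num_draws \<beta> n i}" for i l
    using integral_distr[OF comp[OF that] meas[OF that(1)]] distr[OF that] by simp
  have int: "integrable (esbm k \<mu> \<beta> n) (\<lambda>\<omega>. max (\<alpha> i - dist z (\<omega> (i, l))) 0)"
    if "i \<in> {1..k}" "l \<in> {1..num_draws \<beta> n i}" for i l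
  proof (rule integrable_const_bound[where B = "\<bar>\<alpha> i\<bar>"])
    show "AE \<omega> in esbm k \<mu> \<beta> n. norm (max (\<alpha> i - dist z (\<omega> (i, l))) 0) \<le> \<bar>\<alpha> i\<bar>"
      by (auto intro!: AE_I2 simp: max_def abs_if) (smt (verit) zero_le_dist)+
    show "(\<lambda>\<omega>. max (\<alpha> i - dist z (\<omega> (i, l))) 0) \<in> borel_measurable (esbm k \<mu> \<beta> n)"
      using measurable_compose[OF comp[OF that] meas[OF that(1)]] .
  qed
  have num: "real (num_draws \<beta> n i) = \<beta> i * real n" if "i \<in> {1..k}" for i
    using nat[OF that] by (auto simp: num_draws_def elim!: Nats_cases)
  have "(\<integral>\<omega>. contribution k \<beta> n \<alpha> \<omega> z \<partial>esbm k \<mu> \<beta> n)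
      = (\<Sum>i\<in>{1..k}. \<Sum>l\<in>{1..num_draws \<beta> n i}.
           (\<integral>\<omega>. max (\<alpha> i - dist z (\<omega> (i, l))) 0 \<partial>esbm k \<mu> \<beta> n))"
    unfolding contribution_def
    by (subst Bochner_Integration.integral_sum)
       (auto intro!: int sum.cong Bochner_Integration.integral_sum Bochner_Integration.integrable_sum)
  also have "\<dots> = (\<Sum>i\<in>{1..k}. real (num_draws \<beta> n i) * (\<integral>x. max (\<alpha> i - dist z x) 0 \<partial>\<mu> i))"
    by (intro sum.cong refl) (simp add: exp_eq)
  also have "\<dots> = real n * mean_contribution k \<mu> \<beta> \<alpha> z"
    unfolding mean_contribution_def sum_distrib_left
    by (intro sum.cong refl) (simp add: num mult_ac)
  finally show ?thesis
    using n by simp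
qed

section \<open>The linear program and exact recovery\<close>

definition lp_feasible :: "nat \<Rightarrow> 'p set \<Rightarrow> ('p \<Rightarrow> real) \<Rightarrow> ('p \<Rightarrow> 'p \<Rightarrow> real) \<Rightarrow> bool" where
  "lp_feasible k P y z \<longleftrightarrow>
     (\<forall>q\<in>P. (\<Sum>p\<in>P. z p q) = 1) \<and>
     (\<forall>p\<in>P. \<forall>q\<in>P. z p q \<le> y p) \<and>
     (\<Sum>p\<in>P. y p) = real k \<and>
     (\<forall>p\<in>P. 0 \<le> y p) \<and> (\<forall>p\<in>P. \<forall>q\<in>P. 0 \<le> z p q)"

definition ip_feasible :: "nat \<Rightarrow> 'p set \<Rightarrow> ('p \<Rightarrow> real) \<Rightarrow> ('p \<Rightarrow> 'p \<Rightarrow> real) \<Rightarrow> bool" where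
  "ip_feasible k P y z \<longleftrightarrow>
     lp_feasible k P y z \<and> (\<forall>p\<in>P. y p \<in> {0, 1}) \<and> (\<forall>p\<in>P. \<forall>q\<in>P. z p q \<in> {0, 1})"

definition lp_cost :: "'p :: metric_space set \<Rightarrow> ('p \<Rightarrow> 'p \<Rightarrow> real) \<Rightarrow> real" where
  "lp_cost P z = (\<Sum>p\<in>P. \<Sum>q\<in>P. dist p q * z p q)"

definition lp_optimal ::
  "nat \<Rightarrow> 'p :: metric_space set \<Rightarrow> ('p \<Rightarrow> real) \<Rightarrow> ('p \<Rightarrow> 'p \<Rightarrow> real) \<Rightarrow> bool" where
  "lp_optimal k P y z \<longleftrightarrow>
     lp_feasible k P y z \<and> (\<forall>y' z'. lp_feasible k P y' z' \<longrightarrow> lp_cost P z \<le> lp_cost P z')"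

text \<open>\<open>S i\<close> is the set of points drawn from the \<open>i\<close>-th ball. Values of \<open>y\<close> and \<open>z\<close> outside the set
  of sampled points are not variables of the program, so uniqueness disregards them.\<close>

definition exact_recovery :: "nat \<Rightarrow> (nat \<Rightarrow> 'p :: metric_space set) \<Rightarrow> bool" where
  "exact_recovery k S \<longleftrightarrow>
     (let P = (\<Union>i\<in>{1..k}. S i) in
      \<exists>y z. lp_optimal k P y z \<and>
        (\<forall>y' z'. lp_optimal k P y' z' \<longrightarrow>
           (\<forall>p\<in>P. y' p = y p) \<and> (\<forall>p\<in>P. \<forall>q\<in>P. z' p q = z p q)) \<and>
        ip_feasible k P y z \<and>
        (\<forall>i\<in>{1..k}. \<exists>!p. p \<in> S i \<and> y p = 1) \<and>
        (\<forall>p\<in>P. \<forall>q\<in>P. z p q = 1 \<longrightarrow> (\<exists>i\<in>{1..k}. p \<in> S i \<and> q \<in> S i)))"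

section \<open>High probability\<close>

text \<open>The set \<open>T\<close> contains the admissible values of the parameter \<open>n\<close>. In dimension one, \<open>T\<close> has to
  be restricted to those \<open>n\<close> for which every ball contributes an odd number of draws: the total
  distance from an even number of distinct points of the line is constant between the two middle
  points, so a ball with an even number of draws has two optimal centers, and the linear program has
  no unique optimal solution that recovers the balls.\<close>

definition with_high_probability ::
  "nat set \<Rightarrow> (nat \<Rightarrow> 'w measure) \<Rightarrow> (nat \<Rightarrow> 'w set) \<Rightarrow> bool" where
  "with_high_probability T M A \<longleftrightarrow>
     (\<forall>\<delta>. 0 < \<delta> \<and> \<delta> < 1 \<longrightarrow> (\<exists>N>0. \<forall>n\<in>T. N < n \<longrightarrow> 1 - \<delta> < measure (M n) (A n)))"

end

theory Submission
  imports Defs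
begin

text \<open>A dual solution certifies the integral one. Take the sample point \<open>m i\<close> of the \<open>i\<close>-th ball that
  minimizes the sum of distances to the points of this ball, and give every point of the ball the
  dual value \<open>a i\<close>, which exceeds the average distance of these points to \<open>m i\<close> by \<open>\<gamma> / \<beta> i\<close>. The
  certificate is valid, and the optimum unique, if the contribution of the sample points with
  respect to \<open>a\<close> is \<open>n * \<gamma>\<close> at every \<open>m i\<close> and smaller at all other sample points. By the law of large numbers, uniformly in
  space, \<open>a\<close> is close to \<open>\<alpha>\<close> and the contribution divided by \<open>n\<close> is close to its mean. The mean is
  smaller than \<open>\<gamma>\<close> by a fixed amount away from the centers. Near the center of a ball only this ball
  contributes, without truncation, so a point attains \<open>n * \<gamma>\<close> only if it minimizes the sum of
  distances, and this minimizer is almost surely unique.\<close>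

section \<open>Linear programming duality\<close>

text \<open>The bounds on \<open>\<gamma>\<close> say exactly that \<open>r i < \<alpha> i\<close>
  and that \<open>\<alpha> i\<close> is below the gap of its ball; nothing else about the geometry
  is used near the centers. With \<open>\<alpha>\<close> itself as dual values, the contributions at
  the chosen points would be equal only up to an error, but complementary slackness tolerates none.
  So \<open>a i\<close> is computed from the sample: with \<open>f i\<close> the sum of distances to
  the points of the ball and \<open>N i = \<beta> i * n\<close> their number, the untruncated
  contribution \<open>N i * a i - f i (m i)\<close> equals \<open>n * \<gamma>\<close> for exactly
  one \<open>a i\<close>. Near a center the contribution at \<open>z\<close> is then exactly
  \<open>n * \<gamma> + f i (m i) - f i z\<close>; errors occur only far from the centers, where a
  fixed gap absorbs them. Two equally good medians would destroy the uniqueness of the optimum, so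
  ties must be null events, and on a line parity matters. A second obstacle is measurability:
  \<open>measure\<close> assigns 0 to a nonmeasurable set, and exact recovery quantifies over
  uncountably many solutions of a program whose variables depend on the sample.\<close>

lemma lp_cost_decomposition:
  fixes b :: "'p::metric_space \<Rightarrow> real"
  assumes feas: "lp_feasible k P y z"
  shows "lp_cost P z = (\<Sum>q\<in>P. b q) - u * real k
    + (\<Sum>p\<in>P. \<Sum>q\<in>P. max (dist p q - b q) 0 * z p q)
    + (\<Sum>p\<in>P. \<Sum>q\<in>P. max (b q - dist p q) 0 * (y p - z p q))
    + (\<Sum>p\<in>P. (u - (\<Sum>q\<in>P. max (b q - dist p q) 0)) * y p)"
proof -
  have b: "(\<Sum>q\<in>P. b q) = (\<Sum>p\<in>P. \<Sum>q\<in>P. b q * z p q)"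
  proof -
    have "(\<Sum>q\<in>P. b q) = (\<Sum>q\<in>P. b q * (\<Sum>p\<in>P. z p q))"
      using feas by (intro sum.cong) (auto simp: lp_feasible_def)
    also have "\<dots> = (\<Sum>q\<in>P. \<Sum>p\<in>P. b q * z p q)" by (simp add: sum_distrib_left)
    also have "\<dots> = (\<Sum>p\<in>P. \<Sum>q\<in>P. b q * z p q)" by (rule sum.swap)
    finally show ?thesis .
  qed
  have u: "u * real k = (\<Sum>p\<in>P. u * y p)"
    using feas by (simp add: lp_feasible_def sum_distrib_left[symmetric])
  \<comment> \<open>Write \<open>d = b + (d - b)_+ - (b - d)_+\<close> and split the last factor as
    \<open>z = y - (y - z)\<close>. So \<open>b q\<close> is the multiplier of the assignment of
    \<open>q\<close>, the hinge \<open>(b q - dist p q)_+\<close> that of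
    \<open>z p q \<le> y p\<close>, and \<open>u\<close> that of the number of centers.\<close>
  have pt: "dist p q * z p q = b q * z p q + max (dist p q - b q) 0 * z p q
      + max (b q - dist p q) 0 * (y p - z p q) - max (b q - dist p q) 0 * y p" for p q
    by (auto simp: max_def algebra_simps)
  have C: "(\<Sum>p\<in>P. (u - (\<Sum>q\<in>P. max (b q - dist p q) 0)) * y p)
      = (\<Sum>p\<in>P. u * y p) - (\<Sum>p\<in>P. \<Sum>q\<in>P. max (b q - dist p q) 0 * y p)"
    by (simp add: left_diff_distrib sum_subtractf sum_distrib_right)
  show ?thesis
    unfolding lp_cost_def b u C
    by (subst pt) (simp add: sum.distrib sum_subtractf)
qed

text \<open>Complementary slackness. The three residual sums of \<open>lp_cost_decomposition\<close>
  are nonnegative for every feasible solution and vanish for the one that opens the points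
  \<open>m i\<close>, which is therefore optimal. Uniqueness comes from strictness:
  \<open>less\<close> forces \<open>y\<close> to vanish off the points \<open>m i\<close>,
  \<open>far\<close> forbids serving a point from the center of another ball, and the assignment
  constraints fix the rest.\<close>

lemma exact_recovery_if_dual_certificate:
  fixes S :: "nat \<Rightarrow> 'p::metric_space set"
  assumes fin: "\<And>i. i \<in> {1..k} \<Longrightarrow> finite (S i)"
    and disj: "\<And>i j. i \<in> {1..k} \<Longrightarrow> j \<in> {1..k} \<Longrightarrow> i \<noteq> j \<Longrightarrow> S i \<inter> S j = {}"
    and m: "\<And>i. i \<in> {1..k} \<Longrightarrow> m i \<in> S i"
    and near: "\<And>i q. i \<in> {1..k} \<Longrightarrow> q \<in> S i \<Longrightarrow> dist (m i) q < a i"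
    and far: "\<And>i j q. i \<in> {1..k} \<Longrightarrow> j \<in> {1..k} \<Longrightarrow> i \<noteq> j \<Longrightarrow> q \<in> S j \<Longrightarrow> a j < dist (m i) q"
    and less: "\<And>i p. i \<in> {1..k} \<Longrightarrow> p \<in> S i \<Longrightarrow> p \<noteq> m i
      \<Longrightarrow> (\<Sum>j\<in>{1..k}. \<Sum>q\<in>S j. max (a j - dist p q) 0) < u"
    and eq: "\<And>i. i \<in> {1..k} \<Longrightarrow> (\<Sum>j\<in>{1..k}. \<Sum>q\<in>S j. max (a j - dist (m i) q) 0) = u"
  shows "exact_recovery k S"
proof -
  define P where "P = (\<Union>i\<in>{1..k}. S i)"
  have finP: "finite P" using fin by (auto simp: P_def)
  define idx where "idx q = (THE i. i \<in> {1..k} \<and> q \<in> S i)" for q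
  have idx: "idx q = i" if "i \<in> {1..k}" "q \<in> S i" for i q
    unfolding idx_def using that disj by (intro the_equality) blast+
  have idxP: "idx q \<in> {1..k}" "q \<in> S (idx q)" if q: "q \<in> P" for q
  proof -
    from q obtain i where "i \<in> {1..k}" "q \<in> S i" by (auto simp: P_def)
    then show "idx q \<in> {1..k}" "q \<in> S (idx q)" using idx by simp_all
  qed
  define C where "C p = (\<Sum>q\<in>P. max (a (idx q) - dist p q) 0)" for p
  have sumP: "(\<Sum>q\<in>P. g q) = (\<Sum>j\<in>{1..k}. \<Sum>q\<in>S j. g q)" for g :: "'p \<Rightarrow> real"
    unfolding P_def using fin disj by (intro sum.UNION_disjoint) auto
  have C: "C p = (\<Sum>j\<in>{1..k}. \<Sum>q\<in>S j. max (a j - dist p q) 0)" for p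
    unfolding C_def sumP by (intro sum.cong refl) (simp add: idx)
  have m_inj: "inj_on m {1..k}"
    by (rule inj_onI) (metis idx m)
  define M where "M = m ` {1..k}"
  have M_P: "M \<subseteq> P" using m by (auto simp: M_def P_def)
  have M_S: "p = m i" if "p \<in> M" "p \<in> S i" "i \<in> {1..k}" for p i
  proof -
    obtain j where "j \<in> {1..k}" "p = m j" using \<open>p \<in> M\<close> by (auto simp: M_def)
    then show ?thesis using idx[of j p] idx[of i p] m[of j] that by simp
  qed
  have mM: "m (idx q) \<in> M" if "q \<in> P" for q
    using idxP[OF that] by (auto simp: M_def)
  have C_M: "C p = u" if "p \<in> M" for p
    using that eq unfolding M_def C by blast
  have C_less: "C p < u" if "p \<in> P" "p \<notin> M" for p
  proof -
    from that obtain i where i: "i \<in> {1..k}" "p \<in> S i" by (auto simp: P_def)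
    with that have "p \<noteq> m i" by (auto simp: M_def)
    then show ?thesis unfolding C using less i by blast
  qed
  define y :: "'p \<Rightarrow> real" where "y p = (if p \<in> M then 1 else 0)" for p
  define z :: "'p \<Rightarrow> 'p \<Rightarrow> real" where "z p q = (if p = m (idx q) then 1 else 0)" for p q
  have feas: "lp_feasible k P y z"
  proof -
    have "(\<Sum>p\<in>P. z p q) = 1" if "q \<in> P" for q
    proof -
      have "m (idx q) \<in> P" using mM that M_P by auto
      then show ?thesis using finP by (simp add: z_def)
    qed
    moreover have "(\<Sum>p\<in>P. y p) = k"
      using finP M_P m_inj unfolding y_def
      by (simp add: sum.If_cases Int_absorb1 M_def card_image)
    moreover have "z p q \<le> y p" if "q \<in> P" for p q
      using mM[OF that] by (auto simp: z_def y_def)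
    ultimately show ?thesis
      by (auto simp: lp_feasible_def z_def y_def)
  qed
  let ?gap = "\<lambda>y z. (\<Sum>p\<in>P. \<Sum>q\<in>P. max (dist p q - a (idx q)) 0 * z p q)
    + (\<Sum>p\<in>P. \<Sum>q\<in>P. max (a (idx q) - dist p q) 0 * (y p - z p q))
    + (\<Sum>p\<in>P. (u - C p) * y p)"
  have cost: "lp_cost P z' = (\<Sum>q\<in>P. a (idx q)) - u * real k + ?gap y' z'"
    if "lp_feasible k P y' z'" for y' z'
    using lp_cost_decomposition[OF that, of "\<lambda>q. a (idx q)" u] by (simp add: C_def)
  have Cu: "C p \<le> u" if "p \<in> P" for p
    using C_M C_less that by (cases "p \<in> M") (auto intro: less_imp_le)
  have pos: "0 \<le> max (dist p q - a (idx q)) 0 * z' p q"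
      "0 \<le> max (a (idx q) - dist p q) 0 * (y' p - z' p q)" "0 \<le> (u - C p) * y' p"
    if "lp_feasible k P y' z'" "p \<in> P" "q \<in> P" for y' z' p q
    using that Cu unfolding lp_feasible_def by (auto intro!: mult_nonneg_nonneg)
  have gap_nonneg: "0 \<le> ?gap y' z'" if "lp_feasible k P y' z'" for y' z'
    using that by (intro add_nonneg_nonneg sum_nonneg pos)
  have gap_0: "?gap y z = 0"
  proof -
    have g1: "max (dist p q - a (idx q)) 0 * z p q = 0" if "p \<in> P" "q \<in> P" for p q
    proof -
      obtain i where "i \<in> {1..k}" "q \<in> S i" using \<open>q \<in> P\<close> by (auto simp: P_def)
      then show ?thesis using near[of i q] by (auto simp: z_def idx)
    qed
    have g2: "max (a (idx q) - dist p q) 0 * (y p - z p q) = 0" if "p \<in> P" "q \<in> P" for p q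
    proof -
      obtain i where i: "i \<in> {1..k}" "q \<in> S i" using \<open>q \<in> P\<close> by (auto simp: P_def)
      show ?thesis
      proof (cases "p \<in> M")
        case True
        then obtain j where j: "j \<in> {1..k}" "p = m j" by (auto simp: M_def)
        show ?thesis using far[of j i q] i j True by (cases "i = j") (auto simp: z_def y_def idx)
      next
        case False
        then show ?thesis using mM[OF that(2)] by (auto simp: z_def y_def)
      qed
    qed
    have g3: "(u - C p) * y p = 0" for p
      using C_M by (auto simp: y_def)
    show ?thesis by (simp add: g1 g2 g3 cong: sum.cong)
  qed
  have opt: "lp_optimal k P y z"
    unfolding lp_optimal_def
  proof (intro conjI feas allI impI)
    fix y1 z1 assume f1: "lp_feasible k P y1 z1"
    show "lp_cost P z \<le> lp_cost P z1"
      unfolding cost[OF feas] cost[OF f1] gap_0 using gap_nonneg[OF f1] by linarith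
  qed
  have uniq: "(\<forall>p\<in>P. y' p = y p) \<and> (\<forall>p\<in>P. \<forall>q\<in>P. z' p q = z p q)"
    if opt': "lp_optimal k P y' z'" for y' z'
  proof -
    have f': "lp_feasible k P y' z'" using opt' by (simp add: lp_optimal_def)
    have "lp_cost P z' \<le> lp_cost P z" using opt' feas by (simp add: lp_optimal_def)
    then have "?gap y' z' \<le> 0" using cost[OF f'] cost[OF feas] gap_0 by linarith
    moreover have "0 \<le> (\<Sum>p\<in>P. \<Sum>q\<in>P. max (dist p q - a (idx q)) 0 * z' p q)"
      "0 \<le> (\<Sum>p\<in>P. \<Sum>q\<in>P. max (a (idx q) - dist p q) 0 * (y' p - z' p q))"
      "0 \<le> (\<Sum>p\<in>P. (u - C p) * y' p)"
      by (intro sum_nonneg pos[OF f']; assumption)+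
    ultimately have s0: "(\<Sum>p\<in>P. \<Sum>q\<in>P. max (dist p q - a (idx q)) 0 * z' p q) = 0"
      "(\<Sum>p\<in>P. \<Sum>q\<in>P. max (a (idx q) - dist p q) 0 * (y' p - z' p q)) = 0"
      "(\<Sum>p\<in>P. (u - C p) * y' p) = 0" by linarith+
    have t1: "max (dist p q - a (idx q)) 0 * z' p q = 0" if "p \<in> P" "q \<in> P" for p q
      using s0(1) that finP pos(1)[OF f'] by (simp add: sum_nonneg_eq_0_iff sum_nonneg)
    have t2: "max (a (idx q) - dist p q) 0 * (y' p - z' p q) = 0" if "p \<in> P" "q \<in> P" for p q
      using s0(2) that finP pos(2)[OF f'] by (simp add: sum_nonneg_eq_0_iff sum_nonneg)
    have t3: "(u - C p) * y' p = 0" if "p \<in> P" for p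
      using s0(3) that finP pos(3)[OF f'] by (simp add: sum_nonneg_eq_0_iff)
    have y0: "y' p = 0" if "p \<in> P" "p \<notin> M" for p
      using t3[OF that(1)] C_less[OF that] by simp
    have z_nonneg: "0 \<le> z' p q" "z' p q \<le> y' p" if "p \<in> P" "q \<in> P" for p q
      using f' that by (auto simp: lp_feasible_def)
    have z0: "z' p q = 0" if "p \<in> P" "q \<in> P" "p \<noteq> m (idx q)" for p q
    proof (cases "p \<in> M")
      case True
      then obtain j where j: "j \<in> {1..k}" "p = m j" by (auto simp: M_def)
      obtain i where i: "i \<in> {1..k}" "q \<in> S i" using \<open>q \<in> P\<close> by (auto simp: P_def)
      have "i \<noteq> j" using that(3) i j by (auto simp: idx)
      then show ?thesis using far[of j i q] i j t1[OF that(1,2)] by (simp add: idx)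
    next
      case False
      then show ?thesis using y0 z_nonneg that by fastforce
    qed
    have z1: "z' (m (idx q)) q = 1" if "q \<in> P" for q
    proof -
      have mP: "m (idx q) \<in> P" using mM that M_P by auto
      have "1 = (\<Sum>p\<in>P. z' p q)" using f' that by (simp add: lp_feasible_def)
      also have "\<dots> = (\<Sum>p\<in>P. if p = m (idx q) then z' p q else 0)"
        using z0 that by (intro sum.cong) auto
      also have "\<dots> = z' (m (idx q)) q" using finP mP by simp
      finally show ?thesis by simp
    qed
    have y1: "y' p = 1" if "p \<in> M" for p
    proof -
      obtain i where i: "i \<in> {1..k}" "p = m i" using \<open>p \<in> M\<close> by (auto simp: M_def)
      then have "p \<in> S i" using m by simp
      with i have p: "p \<in> P" "idx p = i" using idx M_P \<open>p \<in> M\<close> by auto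
      \<comment> \<open>At \<open>p = m i\<close> the hinge towards \<open>p\<close> itself is
        \<open>a i\<close>. Its positivity turns \<open>z' p p \<le> y' p\<close> into an equality,
        and \<open>z' p p = 1\<close>.\<close>
      have "0 < a i" using near[OF i(1), of p] \<open>p \<in> S i\<close> by (simp add: i)
      then show ?thesis using t2[OF p(1) p(1)] z1[OF p(1)] p by (simp add: i)
    qed
    show ?thesis
      using y0 y1 z0 z1 by (auto simp: y_def z_def)
  qed
  have "ip_feasible k P y z"
    using feas by (auto simp: ip_feasible_def y_def z_def)
  moreover have "\<exists>!p. p \<in> S i \<and> y p = 1" if "i \<in> {1..k}" for i
    using m[OF that] M_S[OF _ _ that] that by (intro ex1I[of _ "m i"]) (auto simp: y_def M_def split: if_splits)
  moreover have "\<exists>i\<in>{1..k}. p \<in> S i \<and> q \<in> S i" if "p \<in> P" "q \<in> P" "z p q = 1" for p q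
    using that m idxP[OF that(2)] by (intro bexI[of _ "idx q"]) (auto simp: z_def split: if_splits)
  ultimately show ?thesis
    unfolding exact_recovery_def Let_def P_def[symmetric] using opt uniq by blast
qed

section \<open>Measurability of exact recovery\<close>

text \<open>The projection along a compact factor is a closed map. Applied to a compact set of
  competing solutions, this makes the existence of a cheap competitor a closed condition on the
  sample.\<close>

lemma closed_exists_compact:
  fixes K :: "'b::topological_space set" and T :: "('a::topological_space \<times> 'b) set"
  assumes "compact K" "closed T"
  shows "closed {x. \<exists>y\<in>K. (x, y) \<in> T}"
proof -
  let ?Y = "top_of_set K"
  have "compact_space ?Y"
    using assms(1) by (simp add: compact_space_subtopology)
  then have map: "closed_map (prod_topology euclidean ?Y) euclidean (fst :: 'a \<times> 'b \<Rightarrow> 'a)"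
    by (rule Abstract_Topological_Spaces.closed_map_fst)
  have "prod_topology euclidean ?Y = top_of_set (UNIV \<times> K :: ('a \<times> 'b) set)"
    by (simp add: prod_topology_subtopology(2))
  moreover have "closedin (top_of_set (UNIV \<times> K)) ((UNIV \<times> K) \<inter> T)"
    using assms(2) by (rule closedin_closed_Int)
  ultimately have "closedin (prod_topology euclidean ?Y) ((UNIV \<times> K) \<inter> T)"
    by simp
  from map[unfolded closed_map_def, rule_format, OF this]
  have "closed (fst ` ((UNIV \<times> K) \<inter> T))" by simp
  also have "fst ` ((UNIV \<times> K) \<inter> T) = {x. \<exists>y\<in>K. (x, y) \<in> T}" by force
  finally show ?thesis .
qed

text \<open>Tychonoff's theorem, transferred from the product topology to the topology of the
  function type.\<close>

lemma compact_PiE_UNIV: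
  fixes X :: "'i \<Rightarrow> 'a::topological_space set"
  assumes "\<And>i. compact (X i)"
  shows "compact {f. \<forall>i. f i \<in> X i}"
proof -
  have "compactin (product_topology (\<lambda>_. euclidean) UNIV) (PiE UNIV X)"
    unfolding compactin_PiE using assms by simp
  then have "compact (PiE UNIV X)"
    by (simp add: euclidean_product_topology)
  also have "PiE UNIV X = {f. \<forall>i. f i \<in> X i}"
    by (auto simp: PiE_UNIV_domain)
  finally show ?thesis .
qed

text \<open>On the event that two sample points coincide, the program has fewer variables. For the
  measurability of exact recovery it is therefore restated over a fixed set \<open>R\<close> of indices, with
  the random distances only in the cost matrix \<open>d\<close>.\<close>

definition unique_opt :: "nat \<Rightarrow> 'i set \<Rightarrow> ('i \<Rightarrow> 'i \<Rightarrow> real) \<Rightarrow> ('i \<Rightarrow> real) \<Rightarrow> ('i \<Rightarrow> 'i \<Rightarrow> real) \<Rightarrow> bool" where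
  "unique_opt k R d y z \<longleftrightarrow> lp_feasible k R y z \<and>
     (\<forall>y' z'. lp_feasible k R y' z' \<longrightarrow>
        (\<forall>p\<in>R. y' p = y p) \<and> (\<forall>p\<in>R. \<forall>q\<in>R. z' p q = z p q) \<or>
        (\<Sum>p\<in>R. \<Sum>q\<in>R. d p q * z p q) < (\<Sum>p\<in>R. \<Sum>q\<in>R. d p q * z' p q))"

text \<open>A solution is a pair of total functions, so the irrelevant values are pinned to 0 to
  obtain compactness. The others lie between 0 and \<open>k\<close>, because \<open>y p\<close> is
  bounded by the sum of all \<open>y\<close> and \<open>z p q\<close> by \<open>y p\<close>.
  Uncurrying \<open>z\<close> makes every variable a coordinate of one product space.\<close>

lemma compact_lp_feasible:
  assumes "finite R"
  shows "compact {(y, z). lp_feasible k R y (curry z) \<and> (\<forall>p. p \<notin> R \<longrightarrow> y p = 0) \<and>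
    (\<forall>pq. pq \<notin> R \<times> R \<longrightarrow> z pq = 0)}" (is "compact ?F")
proof -
  have c [continuous_intros]: "continuous_on UNIV (\<lambda>x :: ('a \<Rightarrow> real) \<times> ('a \<times> 'a \<Rightarrow> real). fst x p)"
    "continuous_on UNIV (\<lambda>x :: ('a \<Rightarrow> real) \<times> ('a \<times> 'a \<Rightarrow> real). snd x pq)" for p pq
    by (rule continuous_on_product_then_coordinatewise[OF continuous_on_fst[OF continuous_on_id]]
        continuous_on_product_then_coordinatewise[OF continuous_on_snd[OF continuous_on_id]])+
  define B where "B = {y :: 'a \<Rightarrow> real. \<forall>p. y p \<in> (if p \<in> R then {0..real k} else {0})} \<times>
    {z :: 'a \<times> 'a \<Rightarrow> real. \<forall>p. z p \<in> (if p \<in> R \<times> R then {0..real k} else {0})}"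
  have B: "compact B"
    unfolding B_def by (intro compact_Times compact_PiE_UNIV) auto
  define G where "G = (\<Inter>q\<in>R. {x :: ('a \<Rightarrow> real) \<times> ('a \<times> 'a \<Rightarrow> real). (\<Sum>p\<in>R. snd x (p, q)) = 1}) \<inter>
     (\<Inter>p\<in>R. \<Inter>q\<in>R. {x. snd x (p, q) \<le> fst x p}) \<inter> {x. (\<Sum>p\<in>R. fst x p) = real k} \<inter>
     (\<Inter>p\<in>R. {x. 0 \<le> fst x p}) \<inter> (\<Inter>p\<in>R. \<Inter>q\<in>R. {x. 0 \<le> snd x (p, q)})"
  have G: "closed G"
    unfolding G_def
    by (intro closed_Int closed_INT ballI closed_Collect_eq closed_Collect_le continuous_intros)
  have "x \<in> B" if "x \<in> ?F" for x
  proof -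
    have f: "lp_feasible k R (fst x) (curry (snd x))"
      and "\<And>p. p \<notin> R \<Longrightarrow> fst x p = 0" "\<And>p. p \<notin> R \<times> R \<Longrightarrow> snd x p = 0"
      using that unfolding mem_Collect_eq case_prod_unfold by blast+
    moreover have y: "0 \<le> fst x p" "fst x p \<le> k" if "p \<in> R" for p
    proof -
      have "fst x p \<le> (\<Sum>p\<in>R. fst x p)"
        using f that assms by (intro member_le_sum) (auto simp: lp_feasible_def)
      then show "0 \<le> fst x p" "fst x p \<le> k" using f that by (auto simp: lp_feasible_def)
    qed
    moreover have "0 \<le> snd x (p, q)" "snd x (p, q) \<le> k" if "p \<in> R" "q \<in> R" for p q
      using f that y(2)[of p] by (auto simp: lp_feasible_def intro: order_trans)
    ultimately show ?thesis
      by (auto simp: B_def mem_Times_iff)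
  qed
  moreover have "x \<in> G \<longleftrightarrow> lp_feasible k R (fst x) (curry (snd x))" for x
    by (simp add: G_def lp_feasible_def)
  moreover have "(\<forall>p. p \<notin> R \<longrightarrow> fst x p = 0) \<and> (\<forall>pq. pq \<notin> R \<times> R \<longrightarrow> snd x pq = 0)" if "x \<in> B" for x
    using that unfolding B_def mem_Times_iff mem_Collect_eq by (metis singletonD)
  ultimately have "?F = B \<inter> G" unfolding case_prod_unfold by blast
  then show ?thesis using B G by (simp add: compact_Int_closed)
qed

text \<open>For a feasible \<open>(y, z)\<close> the property fails iff some different feasible
  solution costs no more. Competitors that differ in some variable by at least
  \<open>1 / Suc N\<close> form a compact set, so the samples for which one of them is cheap form a
  closed set \<open>Bad N\<close>, and the event is the complement of a countable union of closed
  sets.\<close>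

lemma unique_opt_measurable:
  fixes R :: "'i::countable set"
  assumes fin: "finite R"
  shows "{\<omega> :: 'i \<Rightarrow> 'a::euclidean_space. unique_opt k R (\<lambda>p q. dist (\<omega> p) (\<omega> q)) y z} \<in> sets borel"
proof (cases "lp_feasible k R y z")
  case False
  then show ?thesis by (simp add: unique_opt_def)
next
  case True
  define F where "F = {(y, z). lp_feasible k R y (curry z) \<and> (\<forall>p. p \<notin> R \<longrightarrow> y p = 0) \<and>
    (\<forall>pq. pq \<notin> R \<times> R \<longrightarrow> z pq = 0)}"
  have F: "compact F" unfolding F_def using fin by (rule compact_lp_feasible)
  define far where "far N = {x :: ('i \<Rightarrow> real) \<times> ('i \<times> 'i \<Rightarrow> real).
    (\<exists>p\<in>R. 1 / real (Suc N) \<le> \<bar>fst x p - y p\<bar>) \<or>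
    (\<exists>pq\<in>R \<times> R. 1 / real (Suc N) \<le> \<bar>snd x pq - case_prod z pq\<bar>)}" for N
  have c [continuous_intros]: "continuous_on UNIV (\<lambda>x :: ('i \<Rightarrow> real) \<times> ('i \<times> 'i \<Rightarrow> real). fst x p)"
    "continuous_on UNIV (\<lambda>x :: ('i \<Rightarrow> real) \<times> ('i \<times> 'i \<Rightarrow> real). snd x pq)" for p pq
    by (rule continuous_on_product_then_coordinatewise[OF continuous_on_fst[OF continuous_on_id]]
        continuous_on_product_then_coordinatewise[OF continuous_on_snd[OF continuous_on_id]])+
  have far: "closed (far N)" for N
  proof -
    have "far N = (\<Union>p\<in>R. {x. 1 / real (Suc N) \<le> \<bar>fst x p - y p\<bar>}) \<union>
      (\<Union>pq\<in>R \<times> R. {x. 1 / real (Suc N) \<le> \<bar>snd x pq - case_prod z pq\<bar>})"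
      by (auto simp: far_def)
    also have "closed \<dots>"
      using fin by (intro closed_Un closed_UN finite_cartesian_product closed_Collect_le continuous_intros ballI)
    finally show ?thesis .
  qed
  have K: "compact (F \<inter> far N)" for N
    using F far by (rule compact_Int_closed)
  define cost where "cost \<omega> z' = (\<Sum>p\<in>R. \<Sum>q\<in>R. dist (\<omega> p) (\<omega> q) * z' (p, q))"
    for \<omega> :: "'i \<Rightarrow> 'a" and z' :: "'i \<times> 'i \<Rightarrow> real"
  define T where "T = {x :: ('i \<Rightarrow> 'a) \<times> ('i \<Rightarrow> real) \<times> ('i \<times> 'i \<Rightarrow> real).
     cost (fst x) (snd (snd x)) \<le> cost (fst x) (case_prod z)}"
  have c' [continuous_intros]:
    "continuous_on UNIV (\<lambda>x :: ('i \<Rightarrow> 'a) \<times> ('i \<Rightarrow> real) \<times> ('i \<times> 'i \<Rightarrow> real). fst x p)"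
    "continuous_on UNIV (\<lambda>x :: ('i \<Rightarrow> 'a) \<times> ('i \<Rightarrow> real) \<times> ('i \<times> 'i \<Rightarrow> real). snd (snd x) pq)" for p pq
    by (rule continuous_on_product_then_coordinatewise[OF continuous_on_fst[OF continuous_on_id]]
        continuous_on_product_then_coordinatewise[OF continuous_on_snd[OF continuous_on_snd[OF continuous_on_id]]])+
  have T: "closed T"
    unfolding T_def cost_def by (intro closed_Collect_le continuous_intros)
  define Bad where "Bad N = {\<omega>. \<exists>x\<in>F \<inter> far N. (\<omega>, x) \<in> T}" for N
  have "closed (Bad N)" for N
    unfolding Bad_def using K T by (rule closed_exists_compact)
  then have Bad: "Bad N \<in> sets borel" for N by simp
  have "{\<omega> :: 'i \<Rightarrow> 'a. unique_opt k R (\<lambda>p q. dist (\<omega> p) (\<omega> q)) y z} = - (\<Union>N. Bad N)"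
  proof (intro set_eqI iffI)
    fix \<omega> assume u: "\<omega> \<in> {\<omega> :: 'i \<Rightarrow> 'a. unique_opt k R (\<lambda>p q. dist (\<omega> p) (\<omega> q)) y z}"
    have "\<omega> \<notin> Bad N" for N
    proof
      assume "\<omega> \<in> Bad N"
      then obtain y' z' where yz: "(y', z') \<in> F" "(y', z') \<in> far N" "cost \<omega> z' \<le> cost \<omega> (case_prod z)"
        by (auto simp: Bad_def T_def)
      have "lp_feasible k R y' (curry z')" using yz by (auto simp: F_def)
      with u yz(3) have "\<forall>p\<in>R. y' p = y p" "\<forall>p\<in>R. \<forall>q\<in>R. z' (p, q) = z p q"
        by (auto simp: unique_opt_def cost_def not_less dest!: spec[of _ y'] spec[of _ "curry z'"])
      then show False using yz(2) by (auto simp: far_def)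
    qed
    then show "\<omega> \<in> - (\<Union>N. Bad N)" by auto
  next
    fix \<omega> assume nb: "\<omega> \<in> - (\<Union>N. Bad N)"
    have "(\<Sum>p\<in>R. \<Sum>q\<in>R. dist (\<omega> p) (\<omega> q) * z p q) < (\<Sum>p\<in>R. \<Sum>q\<in>R. dist (\<omega> p) (\<omega> q) * z' p q)"
      if f: "lp_feasible k R y' z'" and ne: "\<not> ((\<forall>p\<in>R. y' p = y p) \<and> (\<forall>p\<in>R. \<forall>q\<in>R. z' p q = z p q))" for y' z'
    proof (rule ccontr)
      assume le: "\<not> ?thesis"
      \<comment> \<open>Values off \<open>R\<close> affect neither feasibility nor cost; cutting
        them off moves the competitor into the compact set \<open>F\<close>.\<close>
      define y1 where "y1 p = (if p \<in> R then y' p else 0)" for p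
      define z1 where "z1 pq = (if pq \<in> R \<times> R then case_prod z' pq else 0)" for pq
      have "(y1, z1) \<in> F" using f by (auto simp: F_def y1_def z1_def lp_feasible_def)
      moreover have "(\<omega>, y1, z1) \<in> T" using le by (auto simp: T_def cost_def z1_def not_less)
      moreover have "\<exists>N. (y1, z1) \<in> far N"
      proof -
        have "(\<exists>p\<in>R. y' p \<noteq> y p) \<or> (\<exists>p\<in>R. \<exists>q\<in>R. z' p q \<noteq> z p q)" using ne by auto
        then show ?thesis
        proof (elim disjE bexE)
          fix p assume p: "p \<in> R" "y' p \<noteq> y p"
          then obtain N where "1 / real (Suc N) < \<bar>y' p - y p\<bar>"
            using reals_Archimedean[of "\<bar>y' p - y p\<bar>"] by (auto simp: inverse_eq_divide)
          then have "(y1, z1) \<in> far N" using p by (auto simp: far_def y1_def intro!: bexI[of _ p])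
          then show ?thesis by blast
        next
          fix p q assume p: "p \<in> R" "q \<in> R" "z' p q \<noteq> z p q"
          then obtain N where "1 / real (Suc N) < \<bar>z' p q - z p q\<bar>"
            using reals_Archimedean[of "\<bar>z' p q - z p q\<bar>"] by (auto simp: inverse_eq_divide)
          then have "\<exists>pq\<in>R \<times> R. 1 / real (Suc N) \<le> \<bar>snd (y1, z1) pq - case_prod z pq\<bar>" using p
            by (intro bexI[of _ "(p, q)"]) (auto simp: z1_def)
          then have "(y1, z1) \<in> far N" by (simp only: far_def mem_Collect_eq simp_thms)
          then show ?thesis by blast
        qed
      qed
      ultimately show False using nb by (auto simp: Bad_def)
    qed
    then show "\<omega> \<in> {\<omega> :: 'i \<Rightarrow> 'a. unique_opt k R (\<lambda>p q. dist (\<omega> p) (\<omega> q)) y z}"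
      using True unfolding unique_opt_def by blast
  qed
  also have "\<dots> \<in> sets borel"
    unfolding Compl_eq_Diff_UNIV using Bad by (intro sets.Diff sets.countable_UN) auto
  finally show ?thesis .
qed

lemma lp_feasible_image:
  assumes "inj_on \<omega> R"
  shows "lp_feasible k (\<omega> ` R) y z \<longleftrightarrow> lp_feasible k R (\<lambda>p. y (\<omega> p)) (\<lambda>p q. z (\<omega> p) (\<omega> q))"
  unfolding lp_feasible_def by (simp add: sum.reindex[OF assms])

lemma lp_cost_image:
  assumes "inj_on \<omega> R"
  shows "lp_cost (\<omega> ` R) z = (\<Sum>p\<in>R. \<Sum>q\<in>R. dist (\<omega> p) (\<omega> q) * z (\<omega> p) (\<omega> q))"
  unfolding lp_cost_def by (simp add: sum.reindex[OF assms])

lemma lp_feasible_cong: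
  assumes "\<And>p. p \<in> R \<Longrightarrow> y p = y' p" "\<And>p q. p \<in> R \<Longrightarrow> q \<in> R \<Longrightarrow> z p q = z' p q"
  shows "lp_feasible k R y z \<longleftrightarrow> lp_feasible k R y' z'"
  unfolding lp_feasible_def using assms by (simp cong: sum.cong)

text \<open>For an injective sample the programs over points and over indices differ by a renaming
  of variables. The strict inequality in \<open>unique_opt\<close> expresses optimality and
  uniqueness at once: a competitor of equal cost would be optimal as well.\<close>

lemma unique_opt_image:
  assumes inj: "inj_on \<omega> R"
  shows "unique_opt k R (\<lambda>p q. dist (\<omega> p) (\<omega> q)) (\<lambda>p. y (\<omega> p)) (\<lambda>p q. z (\<omega> p) (\<omega> q)) \<longleftrightarrow>
    lp_optimal k (\<omega> ` R) y z \<and> (\<forall>y' z'. lp_optimal k (\<omega> ` R) y' z' \<longrightarrow>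
      (\<forall>p\<in>\<omega> ` R. y' p = y p) \<and> (\<forall>p\<in>\<omega> ` R. \<forall>q\<in>\<omega> ` R. z' p q = z p q))"
    (is "?L \<longleftrightarrow> ?R")
proof
  assume L: ?L
  have alt: "(\<forall>p\<in>\<omega> ` R. y' p = y p) \<and> (\<forall>p\<in>\<omega> ` R. \<forall>q\<in>\<omega> ` R. z' p q = z p q) \<or>
      lp_cost (\<omega> ` R) z < lp_cost (\<omega> ` R) z'" if f: "lp_feasible k (\<omega> ` R) y' z'" for y' z'
    using L f unfolding unique_opt_def lp_feasible_image[OF inj] lp_cost_image[OF inj] by fastforce
  have feas: "lp_feasible k (\<omega> ` R) y z"
    using L by (simp add: unique_opt_def lp_feasible_image[OF inj])
  have cost: "lp_cost (\<omega> ` R) z = lp_cost (\<omega> ` R) z'"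
    if "\<forall>p\<in>\<omega> ` R. \<forall>q\<in>\<omega> ` R. z' p q = z p q" for z'
    unfolding lp_cost_def using that by (intro sum.cong) auto
  have opt: "lp_optimal k (\<omega> ` R) y z"
    unfolding lp_optimal_def
  proof (intro conjI feas allI impI)
    fix y' z' assume "lp_feasible k (\<omega> ` R) y' z'"
    from alt[OF this] cost[of z'] show "lp_cost (\<omega> ` R) z \<le> lp_cost (\<omega> ` R) z'" by linarith
  qed
  moreover have "\<not> lp_cost (\<omega> ` R) z < lp_cost (\<omega> ` R) z'" if "lp_optimal k (\<omega> ` R) y' z'" for y' z'
    using that feas by (auto simp: lp_optimal_def not_less)
  ultimately show ?R
    using alt unfolding lp_optimal_def by blast
next
  assume R: ?R
  show ?L
    unfolding unique_opt_def
  proof (intro conjI allI impI)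
    show "lp_feasible k R (\<lambda>p. y (\<omega> p)) (\<lambda>p q. z (\<omega> p) (\<omega> q))"
      using R by (simp add: lp_optimal_def lp_feasible_image[OF inj])
  next
    fix y' z' assume f: "lp_feasible k R y' z'"
    define g where "g = the_inv_into R \<omega>"
    have g: "g (\<omega> p) = p" if "p \<in> R" for p
      using that inj by (simp add: g_def the_inv_into_f_f)
    have f': "lp_feasible k (\<omega> ` R) (\<lambda>p. y' (g p)) (\<lambda>p q. z' (g p) (g q))"
      unfolding lp_feasible_image[OF inj] using f g by (subst lp_feasible_cong) auto
    have c': "lp_cost (\<omega> ` R) (\<lambda>p q. z' (g p) (g q)) = (\<Sum>p\<in>R. \<Sum>q\<in>R. dist (\<omega> p) (\<omega> q) * z' p q)"
      unfolding lp_cost_image[OF inj] using g by (simp cong: sum.cong)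
    show "(\<forall>p\<in>R. y' p = y (\<omega> p)) \<and> (\<forall>p\<in>R. \<forall>q\<in>R. z' p q = z (\<omega> p) (\<omega> q)) \<or>
        (\<Sum>p\<in>R. \<Sum>q\<in>R. dist (\<omega> p) (\<omega> q) * z (\<omega> p) (\<omega> q)) < (\<Sum>p\<in>R. \<Sum>q\<in>R. dist (\<omega> p) (\<omega> q) * z' p q)"
    proof (rule disjCI)
      assume "\<not> (\<Sum>p\<in>R. \<Sum>q\<in>R. dist (\<omega> p) (\<omega> q) * z (\<omega> p) (\<omega> q)) < (\<Sum>p\<in>R. \<Sum>q\<in>R. dist (\<omega> p) (\<omega> q) * z' p q)"
      then have "lp_cost (\<omega> ` R) (\<lambda>p q. z' (g p) (g q)) \<le> lp_cost (\<omega> ` R) z"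
        unfolding c' lp_cost_image[OF inj] by simp
      then have "lp_optimal k (\<omega> ` R) (\<lambda>p. y' (g p)) (\<lambda>p q. z' (g p) (g q))"
        using R f' unfolding lp_optimal_def by (blast intro: order_trans)
      with R have "(\<forall>p\<in>\<omega> ` R. y' (g p) = y p) \<and> (\<forall>p\<in>\<omega> ` R. \<forall>q\<in>\<omega> ` R. z' (g p) (g q) = z p q)"
        by blast
      then show "(\<forall>p\<in>R. y' p = y (\<omega> p)) \<and> (\<forall>p\<in>R. \<forall>q\<in>R. z' p q = z (\<omega> p) (\<omega> q))"
        using g by simp
    qed
  qed
qed

text \<open>Collects the part of \<open>exact_recovery\<close> that does not involve distances. Over
  a fixed family of index sets it is deterministic, and only \<open>unique_opt\<close> depends on
  the sample.\<close>

definition recovers :: "nat \<Rightarrow> (nat \<Rightarrow> 'i set) \<Rightarrow> ('i \<Rightarrow> real) \<Rightarrow> ('i \<Rightarrow> 'i \<Rightarrow> real) \<Rightarrow> bool" where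
  "recovers k T y z \<longleftrightarrow> (let R = (\<Union>i\<in>{1..k}. T i) in
     (\<forall>p\<in>R. y p \<in> {0, 1}) \<and> (\<forall>p\<in>R. \<forall>q\<in>R. z p q \<in> {0, 1}) \<and>
     (\<forall>i\<in>{1..k}. \<exists>!p. p \<in> T i \<and> y p = 1) \<and>
     (\<forall>p\<in>R. \<forall>q\<in>R. z p q = 1 \<longrightarrow> (\<exists>i\<in>{1..k}. p \<in> T i \<and> q \<in> T i)))"

lemma recovers_image:
  assumes inj: "inj_on \<omega> (\<Union>i\<in>{1..k}. T i)"
  shows "recovers k (\<lambda>i. \<omega> ` T i) y z \<longleftrightarrow> recovers k T (\<lambda>p. y (\<omega> p)) (\<lambda>p q. z (\<omega> p) (\<omega> q))"
proof -
  define R where "R = (\<Union>i\<in>{1..k}. T i)"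
  have injR: "inj_on \<omega> R" and sub: "\<And>i. i \<in> {1..k} \<Longrightarrow> T i \<subseteq> R"
    using inj by (auto simp: R_def)
  have mem: "\<omega> p \<in> \<omega> ` T i \<longleftrightarrow> p \<in> T i" if "p \<in> R" "i \<in> {1..k}" for p i
    using inj_on_image_mem_iff[OF injR that(1) sub[OF that(2)]] .
  have ex1: "(\<exists>!p. p \<in> \<omega> ` T i \<and> y p = 1) \<longleftrightarrow> (\<exists>!p. p \<in> T i \<and> y (\<omega> p) = 1)" if "i \<in> {1..k}" for i
  proof -
    have "inj_on \<omega> (T i)" using inj_on_subset[OF injR sub[OF that]] .
    then show ?thesis unfolding inj_on_def by (auto simp: Ex1_def)
  qed
  have bex: "(\<exists>i\<in>{1..k}. \<omega> p \<in> \<omega> ` T i \<and> \<omega> q \<in> \<omega> ` T i) \<longleftrightarrow> (\<exists>i\<in>{1..k}. p \<in> T i \<and> q \<in> T i)"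
    if "p \<in> R" "q \<in> R" for p q
    using mem that by (intro bex_cong refl) simp
  have P: "(\<Union>i\<in>{1..k}. \<omega> ` T i) = \<omega> ` R" by (auto simp: R_def)
  have im: "(\<forall>p\<in>\<omega> ` R. Q p) \<longleftrightarrow> (\<forall>p\<in>R. Q (\<omega> p))" for Q by blast
  show ?thesis
    unfolding recovers_def Let_def P R_def[symmetric] im
    by (intro arg_cong2[where f = "(\<and>)"] ball_cong refl imp_cong ex1 bex)
qed

lemma unique_opt_cong:
  assumes "\<And>p. p \<in> R \<Longrightarrow> y p = y' p" "\<And>p q. p \<in> R \<Longrightarrow> q \<in> R \<Longrightarrow> z p q = z' p q"
  shows "unique_opt k R d y z \<longleftrightarrow> unique_opt k R d y' z'"
  unfolding unique_opt_def using assms lp_feasible_cong[of R y y' z z' k] by (simp cong: sum.cong)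

lemma recovers_cong:
  assumes "\<And>p. p \<in> (\<Union>i\<in>{1..k}. T i) \<Longrightarrow> y p = y' p"
    "\<And>p q. p \<in> (\<Union>i\<in>{1..k}. T i) \<Longrightarrow> q \<in> (\<Union>i\<in>{1..k}. T i) \<Longrightarrow> z p q = z' p q"
  shows "recovers k T y z \<longleftrightarrow> recovers k T y' z'"
proof -
  define R where "R = (\<Union>i\<in>{1..k}. T i)"
  have y: "y p = y' p" if "p \<in> R" for p using assms(1) that by (simp only: R_def)
  have z: "z p q = z' p q" if "p \<in> R" "q \<in> R" for p q using assms(2) that by (simp only: R_def)
  have "(\<exists>!p. p \<in> T i \<and> y p = 1) \<longleftrightarrow> (\<exists>!p. p \<in> T i \<and> y' p = 1)" if "i \<in> {1..k}" for i
  proof -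
    have "T i \<subseteq> R" using that by (auto simp: R_def)
    then have "(\<lambda>p. p \<in> T i \<and> y p = 1) = (\<lambda>p. p \<in> T i \<and> y' p = 1)"
      using y by (intro ext) (metis subsetD)
    then show ?thesis by simp
  qed
  then have "(\<forall>i\<in>{1..k}. \<exists>!p. p \<in> T i \<and> y p = 1) \<longleftrightarrow> (\<forall>i\<in>{1..k}. \<exists>!p. p \<in> T i \<and> y' p = 1)"
    by (intro ball_cong refl)
  then show ?thesis
    unfolding recovers_def Let_def R_def[symmetric] by (simp add: y z cong: ball_cong)
qed

text \<open>A recovering solution is integral, hence given on \<open>R\<close> by two indicator
  functions. The quantifier over real-valued solutions thus becomes one over subsets of
  \<open>R\<close> and \<open>R \<times> R\<close>, which are finitely many in the
  application.\<close>

lemma exact_recovery_image_iff: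
  assumes inj: "inj_on \<omega> (\<Union>i\<in>{1..k}. T i)"
  defines "R \<equiv> \<Union>i\<in>{1..k}. T i"
  shows "exact_recovery k (\<lambda>i. \<omega> ` T i) \<longleftrightarrow>
    (\<exists>Y\<in>Pow R. \<exists>Z\<in>Pow (R \<times> R). recovers k T (indicator Y) (\<lambda>p q. indicator Z (p, q)) \<and>
      unique_opt k R (\<lambda>p q. dist (\<omega> p) (\<omega> q)) (indicator Y) (\<lambda>p q. indicator Z (p, q)))" (is "_ \<longleftrightarrow> ?R")
proof -
  let ?good = "\<lambda>y z. recovers k T y z \<and> unique_opt k R (\<lambda>p q. dist (\<omega> p) (\<omega> q)) y z"
  have good_cong: "?good y' z'"
    if y: "\<And>p. p \<in> R \<Longrightarrow> y p = y' p" and z: "\<And>p q. p \<in> R \<Longrightarrow> q \<in> R \<Longrightarrow> z p q = z' p q"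
      and good: "?good y z" for y z y' z'
  proof -
    have "unique_opt k R (\<lambda>p q. dist (\<omega> p) (\<omega> q)) y z = unique_opt k R (\<lambda>p q. dist (\<omega> p) (\<omega> q)) y' z'"
      by (rule unique_opt_cong) (fact y z)+
    moreover have "recovers k T y z = recovers k T y' z'"
      by (rule recovers_cong) (unfold R_def[symmetric], (fact y z)+)
    ultimately show ?thesis using good by simp
  qed
  have injR: "inj_on \<omega> R" using inj by (simp add: R_def)
  have P: "(\<Union>i\<in>{1..k}. \<omega> ` T i) = \<omega> ` R" by (auto simp: R_def)
  have "exact_recovery k (\<lambda>i. \<omega> ` T i) \<longleftrightarrow> (\<exists>y z. recovers k (\<lambda>i. \<omega> ` T i) y z \<and>
      lp_optimal k (\<omega> ` R) y z \<and> (\<forall>y' z'. lp_optimal k (\<omega> ` R) y' z' \<longrightarrow>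
      (\<forall>p\<in>\<omega> ` R. y' p = y p) \<and> (\<forall>p\<in>\<omega> ` R. \<forall>q\<in>\<omega> ` R. z' p q = z p q)))"
    unfolding exact_recovery_def Let_def P
  proof (intro arg_cong[where f = Ex] ext)
    fix y :: "'b \<Rightarrow> real" and z :: "'b \<Rightarrow> 'b \<Rightarrow> real"
    have "recovers k (\<lambda>i. \<omega> ` T i) y z \<longleftrightarrow> (\<forall>p\<in>\<omega> ` R. y p \<in> {0, 1}) \<and> (\<forall>p\<in>\<omega> ` R. \<forall>q\<in>\<omega> ` R. z p q \<in> {0, 1}) \<and>
        (\<forall>i\<in>{1..k}. \<exists>!p. p \<in> \<omega> ` T i \<and> y p = 1) \<and>
        (\<forall>p\<in>\<omega> ` R. \<forall>q\<in>\<omega> ` R. z p q = 1 \<longrightarrow> (\<exists>i\<in>{1..k}. p \<in> \<omega> ` T i \<and> q \<in> \<omega> ` T i))"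
      unfolding recovers_def Let_def P ..
    moreover have "lp_optimal k (\<omega> ` R) y z \<longrightarrow> lp_feasible k (\<omega> ` R) y z"
      by (simp add: lp_optimal_def)
    ultimately show "(lp_optimal k (\<omega> ` R) y z \<and> (\<forall>y' z'. lp_optimal k (\<omega> ` R) y' z' \<longrightarrow>
        (\<forall>p\<in>\<omega> ` R. y' p = y p) \<and> (\<forall>p\<in>\<omega> ` R. \<forall>q\<in>\<omega> ` R. z' p q = z p q)) \<and>
        ip_feasible k (\<omega> ` R) y z \<and> (\<forall>i\<in>{1..k}. \<exists>!p. p \<in> \<omega> ` T i \<and> y p = 1) \<and>
        (\<forall>p\<in>\<omega> ` R. \<forall>q\<in>\<omega> ` R. z p q = 1 \<longrightarrow> (\<exists>i\<in>{1..k}. p \<in> \<omega> ` T i \<and> q \<in> \<omega> ` T i))) \<longleftrightarrow>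
      (recovers k (\<lambda>i. \<omega> ` T i) y z \<and> lp_optimal k (\<omega> ` R) y z \<and> (\<forall>y' z'. lp_optimal k (\<omega> ` R) y' z' \<longrightarrow>
        (\<forall>p\<in>\<omega> ` R. y' p = y p) \<and> (\<forall>p\<in>\<omega> ` R. \<forall>q\<in>\<omega> ` R. z' p q = z p q)))"
      unfolding ip_feasible_def by argo
  qed
  also have "\<dots> \<longleftrightarrow> (\<exists>y z. ?good (\<lambda>p. y (\<omega> p)) (\<lambda>p q. z (\<omega> p) (\<omega> q)))"
    unfolding unique_opt_image[OF injR] recovers_image[OF inj] ..
  also have "\<dots> \<longleftrightarrow> ?R"
  proof
    assume "\<exists>y z. ?good (\<lambda>p. y (\<omega> p)) (\<lambda>p q. z (\<omega> p) (\<omega> q))"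
    then obtain y z where yz: "?good (\<lambda>p. y (\<omega> p)) (\<lambda>p q. z (\<omega> p) (\<omega> q))" by blast
    define Y where "Y = {p \<in> R. y (\<omega> p) = 1}"
    define Z where "Z = {pq \<in> R \<times> R. z (\<omega> (fst pq)) (\<omega> (snd pq)) = 1}"
    have "\<forall>p\<in>R. y (\<omega> p) \<in> {0, 1}" "\<forall>p\<in>R. \<forall>q\<in>R. z (\<omega> p) (\<omega> q) \<in> {0, 1}"
      using yz unfolding recovers_def Let_def R_def by blast+
    then have vy: "\<And>p. p \<in> R \<Longrightarrow> y (\<omega> p) = indicator Y p"
      and vz: "\<And>p q. p \<in> R \<Longrightarrow> q \<in> R \<Longrightarrow> z (\<omega> p) (\<omega> q) = indicator Z (p, q)"
      by (auto simp: Y_def Z_def indicator_def)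
    have "?good (indicator Y) (\<lambda>p q. indicator Z (p, q))"
      by (rule good_cong[OF vy vz yz])
    moreover have "Y \<in> Pow R" "Z \<in> Pow (R \<times> R)" by (auto simp: Y_def Z_def)
    ultimately show ?R by blast
  next
    assume ?R
    then obtain Y Z where YZ: "?good (indicator Y) (\<lambda>p q. indicator Z (p, q))" by blast
    define g where "g = the_inv_into R \<omega>"
    have g: "g (\<omega> p) = p" if "p \<in> R" for p
      using that injR by (simp add: g_def the_inv_into_f_f)
    have "?good (\<lambda>p. indicator Y (g (\<omega> p))) (\<lambda>p q. indicator Z (g (\<omega> p), g (\<omega> q)))"
    proof (rule good_cong[OF _ _ YZ])
      show "indicator Y p = (indicator Y (g (\<omega> p)) :: real)" if "p \<in> R" for p
        using g[OF that] by simp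
      show "indicator Z (p, q) = (indicator Z (g (\<omega> p), g (\<omega> q)) :: real)" if "p \<in> R" "q \<in> R" for p q
        using g that by simp
    qed
    then show "\<exists>y z. ?good (\<lambda>p. y (\<omega> p)) (\<lambda>p q. z (\<omega> p) (\<omega> q))"
      by (intro exI[of _ "\<lambda>p. indicator Y (g p)"] exI[of _ "\<lambda>p q. indicator Z (g p, g q)"])
  qed
  finally show ?thesis .
qed

text \<open>Coinciding sample points form one point of the program, so the event is split according to
  a choice \<open>T\<close> of indices that represents every point once.\<close>

definition represents :: "nat \<Rightarrow> (nat \<Rightarrow> 'i set) \<Rightarrow> (nat \<Rightarrow> 'i set) \<Rightarrow> ('i \<Rightarrow> 'a) \<Rightarrow> bool" where
  "represents k J T \<omega> \<longleftrightarrow>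
    (\<forall>p\<in>\<Union>i\<in>{1..k}. T i. \<forall>q\<in>\<Union>i\<in>{1..k}. T i. \<omega> p = \<omega> q \<longrightarrow> p = q) \<and>
    (\<forall>i\<in>{1..k}. (\<forall>p\<in>T i. \<exists>q\<in>J i. \<omega> p = \<omega> q) \<and> (\<forall>q\<in>J i. \<exists>p\<in>T i. \<omega> p = \<omega> q))"

lemma represents_exists:
  "\<exists>T\<in>{1..k} \<rightarrow>\<^sub>E Pow (\<Union>i\<in>{1..k}. J i). represents k J T \<omega>"
proof -
  define I where "I = (\<Union>i\<in>{1..k}. J i)"
  obtain Q where Q: "Q \<subseteq> I" "inj_on \<omega> Q" "\<omega> ` I = \<omega> ` Q"
    using subset_image_inj[of "\<omega> ` I" \<omega> I] by auto
  \<comment> \<open>If a point was drawn from two balls, its only representative belongs to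
    \<open>T i\<close> for both of them, so \<open>T i\<close> need not be a subset of
    \<open>J i\<close>.\<close>
  define T where "T = (\<lambda>i\<in>{1..k}. {p \<in> Q. \<omega> p \<in> \<omega> ` J i})"
  have T: "T i = {p \<in> Q. \<omega> p \<in> \<omega> ` J i}" if "i \<in> {1..k}" for i
    using that by (simp add: T_def)
  have "(\<Union>i\<in>{1..k}. T i) \<subseteq> Q" using T by auto
  then have "\<forall>p\<in>\<Union>i\<in>{1..k}. T i. \<forall>q\<in>\<Union>i\<in>{1..k}. T i. \<omega> p = \<omega> q \<longrightarrow> p = q"
    using inj_onD[OF Q(2)] by (meson subsetD)
  moreover have "\<exists>p\<in>T i. \<omega> p = \<omega> q" if "i \<in> {1..k}" "q \<in> J i" for i q
  proof -
    have "q \<in> I" using that by (auto simp: I_def)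
    then have "\<omega> q \<in> \<omega> ` Q" using Q(3) by blast
    then obtain p where "p \<in> Q" "\<omega> p = \<omega> q" by (metis imageE)
    then show ?thesis using that T[OF that(1)] by (intro bexI[of _ p]) auto
  qed
  moreover have "\<exists>q\<in>J i. \<omega> p = \<omega> q" if "i \<in> {1..k}" "p \<in> T i" for i p
    using that T[OF that(1)] by blast
  moreover have "T \<in> {1..k} \<rightarrow>\<^sub>E Pow I"
    using Q(1) by (auto simp: T_def)
  ultimately show ?thesis
    unfolding represents_def I_def by blast
qed

lemma exact_recovery_represents_iff:
  assumes "represents k J T \<omega>"
  shows "exact_recovery k (\<lambda>i. \<omega> ` J i) \<longleftrightarrow> exact_recovery k (\<lambda>i. \<omega> ` T i)"
proof -
  have im: "\<omega> ` J i = \<omega> ` T i" if "i \<in> {1..k}" for i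
  proof (intro subset_antisym image_subsetI)
    fix q assume "q \<in> J i"
    with assms that obtain p where "p \<in> T i" "\<omega> p = \<omega> q" unfolding represents_def by blast
    then show "\<omega> q \<in> \<omega> ` T i" by (metis imageI)
  next
    fix p assume "p \<in> T i"
    with assms that obtain q where "q \<in> J i" "\<omega> p = \<omega> q" unfolding represents_def by blast
    then show "\<omega> p \<in> \<omega> ` J i" by (metis imageI)
  qed
  have "(\<Union>i\<in>{1..k}. \<omega> ` J i) = (\<Union>i\<in>{1..k}. \<omega> ` T i)"
    using im by (intro SUP_cong refl) simp
  moreover have "(\<forall>i\<in>{1..k}. \<exists>!p. p \<in> \<omega> ` J i \<and> y p = 1) \<longleftrightarrow> (\<forall>i\<in>{1..k}. \<exists>!p. p \<in> \<omega> ` T i \<and> y p = 1)"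
    for y :: "'b \<Rightarrow> real"
    by (intro ball_cong refl) (simp only: im)
  moreover have "(\<exists>i\<in>{1..k}. p \<in> \<omega> ` J i \<and> q \<in> \<omega> ` J i) \<longleftrightarrow> (\<exists>i\<in>{1..k}. p \<in> \<omega> ` T i \<and> q \<in> \<omega> ` T i)" for p q
    by (intro bex_cong refl) (simp only: im)
  ultimately show ?thesis
    unfolding exact_recovery_def by (simp only:)
qed

text \<open>There are finitely many candidates \<open>T\<close>, and the sample is injective on the
  indices of a representing one. So the event is a finite combination of equalities between
  coordinates and of events \<open>unique_opt\<close>.\<close>

lemma exact_recovery_borel:
  fixes J :: "nat \<Rightarrow> 'i::countable set"
  assumes fin: "\<And>i. i \<in> {1..k} \<Longrightarrow> finite (J i)"
  shows "{\<omega> :: 'i \<Rightarrow> 'a::euclidean_space. exact_recovery k (\<lambda>i. \<omega> ` J i)} \<in> sets borel"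
proof -
  define I where "I = (\<Union>i\<in>{1..k}. J i)"
  have finI: "finite I" using fin by (auto simp: I_def)
  define R where "R T = (\<Union>i\<in>{1..k}. T i)" for T :: "nat \<Rightarrow> 'i set"
  let ?TT = "{1..k} \<rightarrow>\<^sub>E Pow I"
  define ER where "ER T \<omega> \<longleftrightarrow> (\<exists>Y\<in>Pow (R T). \<exists>Z\<in>Pow (R T \<times> R T).
      recovers k T (indicator Y) (\<lambda>p q. indicator Z (p, q)) \<and>
      unique_opt k (R T) (\<lambda>p q. dist (\<omega> p) (\<omega> q)) (indicator Y) (\<lambda>p q. indicator Z (p, q)))"
    for T and \<omega> :: "'i \<Rightarrow> 'a"
  have iff: "exact_recovery k (\<lambda>i. \<omega> ` J i) \<longleftrightarrow> (\<exists>T\<in>?TT. represents k J T \<omega> \<and> ER T \<omega>)" for \<omega> :: "'i \<Rightarrow> 'a"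
  proof -
    have "exact_recovery k (\<lambda>i. \<omega> ` J i) \<longleftrightarrow> ER T \<omega>" if rep: "represents k J T \<omega>" for T
    proof -
      have inj: "inj_on \<omega> (\<Union>i\<in>{1..k}. T i)"
        using rep unfolding inj_on_def represents_def by blast
      show ?thesis
        unfolding exact_recovery_represents_iff[OF rep] exact_recovery_image_iff[OF inj] ER_def R_def ..
    qed
    then show ?thesis using represents_exists[of k J \<omega>] unfolding I_def by blast
  qed
  have "closed {\<omega> :: 'i \<Rightarrow> 'a. \<omega> p = \<omega> q}" for p q
    by (intro closed_Collect_eq continuous_on_product_coordinates)
  then have eq [measurable]: "Measurable.pred borel (\<lambda>\<omega> :: 'i \<Rightarrow> 'a. \<omega> p = \<omega> q)" for p q
    by (simp add: pred_def)
  have uo: "Measurable.pred borel (\<lambda>\<omega> :: 'i \<Rightarrow> 'a. unique_opt k Q (\<lambda>p q. dist (\<omega> p) (\<omega> q)) y z)" if "finite Q" for Q y z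
    using unique_opt_measurable[OF that] by (simp add: pred_def)
  have "Measurable.pred borel (\<lambda>\<omega> :: 'i \<Rightarrow> 'a. \<exists>T\<in>?TT. represents k J T \<omega> \<and> ER T \<omega>)"
  proof (rule pred_intros_finite)
    show "finite ?TT" using finI by (intro finite_PiE) auto
    fix T assume TT: "T \<in> ?TT"
    have fT: "finite (T i)" if "i \<in> {1..k}" for i
      using PiE_mem[OF TT that] finI by (auto intro: finite_subset)
    then have fR: "finite (R T)" by (auto simp: R_def)
    have "Measurable.pred borel (ER T)"
      unfolding ER_def using fR by (intro pred_intros_finite pred_intros_logic uo) auto
    moreover have "Measurable.pred borel (represents k J T :: ('i \<Rightarrow> 'a) \<Rightarrow> bool)"
      unfolding represents_def R_def[symmetric] using fR fT fin
      by (intro pred_intros_finite pred_intros_logic eq) auto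
    ultimately show "Measurable.pred borel (\<lambda>\<omega>. represents k J T \<omega> \<and> ER T \<omega>)"
      by (intro pred_intros_logic)
  qed
  then show ?thesis by (simp add: pred_def iff)
qed

lemma borel_measurable_PiM_component:
  assumes sets: "\<And>p. p \<in> I \<Longrightarrow> sets (M p) = sets (restrict_space borel (X p))" and p: "p \<in> I"
  shows "(\<lambda>\<omega>. \<omega> p) \<in> borel_measurable (PiM I M)"
proof -
  have "(\<lambda>x. x) \<in> borel_measurable (restrict_space borel (X p))"
    by (rule measurable_restrict_space1) simp
  then have "(\<lambda>x. x) \<in> borel_measurable (M p)"
    using measurable_cong_sets[OF sets[OF p] refl] by blast
  then have "(\<lambda>\<omega>. (\<lambda>x. x) (\<omega> p)) \<in> borel_measurable (PiM I M)"
    by (rule measurable_compose[OF measurable_component_singleton[OF p]])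
  then show ?thesis by simp
qed

text \<open>The sample space is mapped into the space of all functions, where the Borel sets form
  the product sigma-algebra because the index type is countable.\<close>

lemma exact_recovery_sets_PiM:
  fixes J :: "nat \<Rightarrow> 'i::countable set" and M :: "'i \<Rightarrow> ('a::euclidean_space) measure"
  assumes fin: "\<And>i. i \<in> {1..k} \<Longrightarrow> finite (J i)"
    and M: "\<And>p. p \<in> I \<Longrightarrow> sets (M p) = sets (restrict_space borel (X p))"
  shows "{\<omega> \<in> space (PiM I M). exact_recovery k (\<lambda>i. \<omega> ` J i)} \<in> sets (PiM I M)"
proof -
  have "(\<lambda>\<omega>. \<omega>) \<in> measurable (PiM I M) (PiM UNIV (\<lambda>_. borel))"
  proof (rule measurable_PiM_single')
    fix p :: 'i
    show "(\<lambda>\<omega>. \<omega> p) \<in> borel_measurable (PiM I M)"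
    proof (cases "p \<in> I")
      case True
      with M show ?thesis by (rule borel_measurable_PiM_component)
    next
      case False
      \<comment> \<open>Elements of the product space take the constant value
        \<open>undefined\<close> outside \<open>I\<close>.\<close>
      have "(\<lambda>\<omega>. undefined :: 'a) \<in> borel_measurable (PiM I M)" by simp
      also have "?this \<longleftrightarrow> ?thesis"
        using False by (intro measurable_cong) (auto simp: space_PiM PiE_def extensional_def)
      finally show ?thesis .
    qed
  qed auto
  then have "(\<lambda>\<omega>. \<omega>) \<in> borel_measurable (PiM I M)"
    using measurable_cong_sets[OF refl sets_PiM_equal_borel] by blast
  from measurable_sets[OF this exact_recovery_borel[OF fin]]
  show ?thesis by (simp add: vimage_def Int_def conj_commute)
qed

section \<open>Uniqueness of medians\<close>

text \<open>The weak midpoint inequality is the triangle inequality. It is strict for the summand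
  \<open>q0\<close>, since by Pythagoras a step orthogonal to \<open>x - g q0\<close> increases the
  distance in both directions, also when \<open>x = g q0\<close>.\<close>

lemma sum_dist_midpoint_less:
  fixes x :: "'a::euclidean_space" and g :: "'i \<Rightarrow> 'a"
  assumes fin: "finite Q" and q0: "q0 \<in> Q" and v: "v \<noteq> 0" "orthogonal (x - g q0) v"
  shows "2 * (\<Sum>q\<in>Q. dist x (g q)) < (\<Sum>q\<in>Q. dist (x + v) (g q)) + (\<Sum>q\<in>Q. dist (x - v) (g q))"
proof -
  have le: "2 * dist x (g q) \<le> dist (x + v) (g q) + dist (x - v) (g q)" for q
  proof -
    have "norm ((x + v - g q) + (x - v - g q)) \<le> dist (x + v) (g q) + dist (x - v) (g q)"
      unfolding dist_norm by (rule norm_triangle_ineq)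
    also have "(x + v - g q) + (x - v - g q) = 2 *\<^sub>R (x - g q)"
      by (simp add: scaleR_2 algebra_simps)
    finally show ?thesis by (simp add: dist_norm)
  qed
  have lt: "norm w < norm (w + u)" if "u \<noteq> 0" "orthogonal w u" for w u :: 'a
  proof -
    have "(norm w)\<^sup>2 < (norm (w + u))\<^sup>2"
      using norm_add_Pythagorean[OF that(2)] that(1) by simp
    then show ?thesis by (rule power2_less_imp_less) simp
  qed
  have "dist x (g q0) < dist (x + v) (g q0)" "dist x (g q0) < dist (x - v) (g q0)"
    using lt[of v "x - g q0"] lt[of "- v" "x - g q0"] v
    by (simp_all add: dist_norm algebra_simps orthogonal_clauses)
  then have "2 * dist x (g q0) < dist (x + v) (g q0) + dist (x - v) (g q0)" by simp
  then have "(\<Sum>q\<in>Q. 2 * dist x (g q)) < (\<Sum>q\<in>Q. dist (x + v) (g q) + dist (x - v) (g q))"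
    using le fin q0 by (intro sum_strict_mono_ex1) auto
  then show ?thesis by (simp add: sum_distrib_left sum.distrib)
qed

text \<open>The sum of distances is convex and exceeds its value at a point somewhere near that point, so a
  level set lies in the boundary of the convex sublevel set.\<close>

lemma negligible_sum_dist_level_set:
  fixes g :: "'i \<Rightarrow> 'a::euclidean_space"
  assumes dim: "2 \<le> DIM('a)" and fin: "finite Q" and ne: "Q \<noteq> {}"
  shows "negligible {x. (\<Sum>q\<in>Q. dist x (g q)) = b}"
proof -
  define f where "f x = (\<Sum>q\<in>Q. dist x (g q))" for x
  define S where "S = {x. f x \<le> b}"
  have "convex_on UNIV f"
    unfolding f_def using fin
  proof induction
    case (insert q Q)
    then show ?case
      using convex_on_dist[of UNIV "g q"] by (auto intro!: convex_on_add simp: dist_commute)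
  qed (simp add: convex_on_const)
  then have "convex S"
    unfolding S_def
  proof (intro convexI)
    fix x y and u v :: real
    assume conv: "convex_on UNIV f" and xy: "x \<in> {x. f x \<le> b}" "y \<in> {x. f x \<le> b}"
      and uv: "0 \<le> u" "0 \<le> v" "u + v = 1"
    have "f (u *\<^sub>R x + v *\<^sub>R y) \<le> u * f x + v * f y"
      using conv uv by (simp add: convex_on_def)
    also have "\<dots> \<le> b" using xy uv by (intro convex_bound_le) auto
    finally show "u *\<^sub>R x + v *\<^sub>R y \<in> {x. f x \<le> b}" by simp
  qed
  have "f x \<noteq> b" if int: "x \<in> interior S" for x
  proof
    assume fx: "f x = b"
    obtain e where e: "e > 0" "cball x e \<subseteq> S"
      using int mem_interior_cball by blast
    obtain q0 where q0: "q0 \<in> Q" using ne by blast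
    \<comment> \<open>This is where the dimension enters: one vector does not span the space, so
      there is a direction orthogonal to it. Both \<open>x + v\<close> and \<open>x - v\<close> lie
      in the sublevel set, against the strict midpoint inequality.\<close>
    have "dim {x - g q0} < DIM('a)"
      using dim_le_card[of "{x - g q0}"] dim by (auto simp: dim_singleton split: if_splits)
    then obtain u where u: "u \<noteq> 0" "orthogonal u (x - g q0)"
      using orthogonal_to_subspace_exists[of "{x - g q0}"] by (metis insertI1 span_base)
    define v where "v = (e / norm u) *\<^sub>R u"
    have v: "v \<noteq> 0" "orthogonal (x - g q0) v" "norm v = e"
      using u e by (auto simp: v_def orthogonal_commute orthogonal_clauses)
    then have "x + v \<in> S" "x - v \<in> S" using e(2) by (auto simp: subset_iff dist_norm)
    then show False
      using sum_dist_midpoint_less[where g = g, OF fin q0 v(1,2)] fx by (auto simp: f_def S_def)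
  qed
  moreover have "{x. f x = b} \<subseteq> closure S"
    using closure_subset[of S] by (auto simp: S_def)
  ultimately have "{x. f x = b} \<subseteq> frontier S"
    unfolding frontier_def by blast
  then show ?thesis
    using negligible_convex_frontier[OF \<open>convex S\<close>] negligible_subset unfolding f_def by blast
qed

text \<open>If \<open>a < b\<close> both minimize, then by convexity so does the point
  \<open>s\<close> of \<open>X\<close> that follows \<open>a\<close>. But from \<open>a\<close> to
  \<open>s\<close> the sum of distances is affine, with slope the number of points up to
  \<open>a\<close> minus the number beyond. This has the parity of \<open>card X\<close>, so it is
  not 0.\<close>

lemma unique_median_real:
  fixes X :: "real set"
  assumes fin: "finite X" and odd: "odd (card X)" and p: "p \<in> X" "p' \<in> X"
    and min: "\<And>x. x \<in> X \<Longrightarrow> (\<Sum>q\<in>X. \<bar>p - q\<bar>) \<le> (\<Sum>q\<in>X. \<bar>x - q\<bar>)"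
      "\<And>x. x \<in> X \<Longrightarrow> (\<Sum>q\<in>X. \<bar>p' - q\<bar>) \<le> (\<Sum>q\<in>X. \<bar>x - q\<bar>)"
  shows "p = p'"
proof -
  define f where "f x = (\<Sum>q\<in>X. \<bar>x - q\<bar>)" for x
  have no_less: False if lt: "a < b" and ab: "a \<in> X" "b \<in> X"
    and ma: "\<And>x. x \<in> X \<Longrightarrow> f a \<le> f x" and mb: "\<And>x. x \<in> X \<Longrightarrow> f b \<le> f x" for a b
  proof -
    define s where "s = Min {x \<in> X. a < x}"
    have "s \<in> {x \<in> X. a < x}" unfolding s_def using fin lt ab by (intro Min_in) auto
    then have s: "s \<in> X" "a < s" by auto
    have s_le: "s \<le> x" if "x \<in> X" "a < x" for x
      unfolding s_def using fin that by (intro Min_le) auto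
    have "f s \<le> f a"
    proof -
      \<comment> \<open>Convexity of the absolute value at \<open>s\<close>, a convex combination of
        \<open>a\<close> and \<open>b\<close>, with the denominator \<open>b - a\<close>
        cleared.\<close>
      have "(b - a) * \<bar>s - q\<bar> \<le> (b - s) * \<bar>a - q\<bar> + (s - a) * \<bar>b - q\<bar>" for q
      proof -
        have "(b - a) * \<bar>s - q\<bar> = \<bar>(b - a) * (s - q)\<bar>" using lt by (simp add: abs_mult)
        also have "(b - a) * (s - q) = (b - s) * (a - q) + (s - a) * (b - q)" by (simp add: algebra_simps)
        also have "\<bar>(b - s) * (a - q) + (s - a) * (b - q)\<bar> \<le> (b - s) * \<bar>a - q\<bar> + (s - a) * \<bar>b - q\<bar>"
          using s(2) s_le[OF ab(2) lt] by (intro order_trans[OF abs_triangle_ineq]) (simp add: abs_mult)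
        finally show ?thesis .
      qed
      then have "(\<Sum>q\<in>X. (b - a) * \<bar>s - q\<bar>) \<le> (\<Sum>q\<in>X. (b - s) * \<bar>a - q\<bar> + (s - a) * \<bar>b - q\<bar>)"
        by (rule sum_mono)
      then have "(b - a) * f s \<le> (b - s) * f a + (s - a) * f b"
        by (simp add: f_def sum.distrib sum_distrib_left)
      also have "f b = f a" using ma[OF ab(2)] mb[OF ab(1)] by simp
      also have "(b - s) * f a + (s - a) * f a = (b - a) * f a" by (simp add: algebra_simps)
      finally show ?thesis using lt by simp
    qed
    then have "f s = f a" using ma[OF s(1)] by simp
    moreover have "f s - f a = (s - a) * (2 * real (card {q \<in> X. q \<le> a}) - real (card X))"
    proof -
      have "f s - f a = (\<Sum>q\<in>X. \<bar>s - q\<bar> - \<bar>a - q\<bar>)" by (simp add: f_def sum_subtractf)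
      also have "\<dots> = (\<Sum>q\<in>X. (s - a) * (2 * (if q \<le> a then 1 else 0) - 1))"
      proof (intro sum.cong refl)
        fix q assume "q \<in> X"
        then show "\<bar>s - q\<bar> - \<bar>a - q\<bar> = (s - a) * (2 * (if q \<le> a then 1 else 0) - 1)"
          using s_le[of q] s(2) by (cases "q \<le> a") auto
      qed
      also have "\<dots> = (s - a) * (2 * (\<Sum>q\<in>X. if q \<le> a then 1 else 0) - real (card X))"
        by (simp add: sum_distrib_left[symmetric] sum_subtractf)
      also have "(\<Sum>q\<in>X. if q \<le> a then 1 else 0 :: real) = real (card {q \<in> X. q \<le> a})"
        using fin by (simp add: sum.If_cases Int_def)
      finally show ?thesis .
    qed
    ultimately have "real (card X) = real (2 * card {q \<in> X. q \<le> a})" using s(2) by simp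
    then have "card X = 2 * card {q \<in> X. q \<le> a}" by (simp only: of_nat_eq_iff)
    then show False using odd by simp
  qed
  show ?thesis
    using no_less[of p p'] no_less[of p' p] p min unfolding f_def by (meson linorder_neqE)
qed

lemma unique_median_vec:
  fixes X :: "(real ^ 'm) set"
  assumes dim: "CARD('m) = 1" and fin: "finite X" and odd: "odd (card X)" and p: "p \<in> X" "p' \<in> X"
    and min: "\<And>x. x \<in> X \<Longrightarrow> (\<Sum>q\<in>X. dist p q) \<le> (\<Sum>q\<in>X. dist x q)"
      "\<And>x. x \<in> X \<Longrightarrow> (\<Sum>q\<in>X. dist p' q) \<le> (\<Sum>q\<in>X. dist x q)"
  shows "p = p'"
proof -
  obtain i :: 'm where i: "UNIV = {i}" using dim by (rule card_1_singletonE)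
  have dist: "dist x y = \<bar>x $ i - y $ i\<bar>" for x y :: "real ^ 'm"
    by (simp add: dist_vec_def i L2_set_def dist_real_def)
  have inj: "inj_on (\<lambda>x. x $ i) X"
    by (rule inj_onI) (metis dist dist_eq_0_iff abs_0 diff_self)
  have sum: "(\<Sum>q\<in>X. dist x q) = (\<Sum>q\<in>(\<lambda>x. x $ i) ` X. \<bar>x $ i - q\<bar>)" for x
    by (simp add: sum.reindex[OF inj] dist)
  have "p $ i = p' $ i"
    using fin odd p min unfolding sum
    by (intro unique_median_real[of "(\<lambda>x. x $ i) ` X"]) (auto simp: card_image[OF inj])
  then show ?thesis using dist[of p p'] by simp
qed

text \<open>Fubini: the exceptional set is null if all its sections in the coordinate
  \<open>p\<close> are null.\<close>

lemma AE_PiM_if_AE_component: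
  assumes fin: "finite I" and p: "p \<in> I" and prob: "\<And>i. i \<in> I \<Longrightarrow> prob_space (M i)"
    and meas: "{\<omega> \<in> space (PiM I M). \<not> P \<omega>} \<in> sets (PiM I M)"
    and AE: "\<And>\<omega>. \<omega> \<in> space (PiM (I - {p}) M) \<Longrightarrow> AE x in M p. P (fun_upd \<omega> p x)"
  shows "AE \<omega> in PiM I M. P \<omega>"
proof -
  \<comment> \<open>\<open>product_sigma_finite\<close> asks for a sigma-finite measure at every
    index, so the indices outside \<open>I\<close> receive a point mass.\<close>
  define N where "N i = (if i \<in> I then M i else return (count_space UNIV) undefined)" for i
  have "prob_space (N i)" for i
    by (auto simp: N_def prob intro!: prob_space_return)
  then interpret product_sigma_finite N
    by (intro product_sigma_finite.intro prob_space_imp_sigma_finite)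
  have PI: "PiM I M = PiM (insert p (I - {p})) N"
    using p by (intro PiM_cong) (auto simp: N_def)
  have PI': "PiM (I - {p}) M = PiM (I - {p}) N" by (intro PiM_cong) (auto simp: N_def)
  have Np: "N p = M p" using p by (simp add: N_def)
  define A where "A = {\<omega> \<in> space (PiM I M). \<not> P \<omega>}"
  have A: "A \<in> sets (PiM (insert p (I - {p})) N)" using meas by (simp add: A_def PI)
  have "emeasure (PiM I M) A = (\<integral>\<^sup>+ \<omega>. indicator A \<omega> \<partial>PiM (insert p (I - {p})) N)"
    using A by (simp add: PI)
  also have "\<dots> = (\<integral>\<^sup>+ \<omega>. (\<integral>\<^sup>+ x. indicator A (fun_upd \<omega> p x) \<partial>N p) \<partial>PiM (I - {p}) N)"
    using fin A by (intro product_nn_integral_insert) auto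
  also have "\<dots> = (\<integral>\<^sup>+ \<omega>. 0 \<partial>PiM (I - {p}) N)"
  proof (intro nn_integral_cong)
    fix \<omega> assume \<omega>: "\<omega> \<in> space (PiM (I - {p}) N)"
    have "AE x in N p. indicator A (fun_upd \<omega> p x) = (0 :: ennreal)"
      using AE[OF \<omega>[folded PI']] unfolding Np by eventually_elim (auto simp: A_def)
    then have "(\<integral>\<^sup>+ x. indicator A (fun_upd \<omega> p x) \<partial>N p) = (\<integral>\<^sup>+ x. 0 \<partial>N p)"
      by (rule nn_integral_cong_AE)
    then show "(\<integral>\<^sup>+ x. indicator A (fun_upd \<omega> p x) \<partial>N p) = 0" by simp
  qed
  finally have "emeasure (PiM I M) A = 0" by simp
  with meas have "A \<in> null_sets (PiM I M)" by (simp add: A_def null_setsI)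
  then show ?thesis by (rule AE_I') (auto simp: A_def)
qed

lemma measurable_restrict_cball:
  fixes h :: "'a::euclidean_space \<Rightarrow> real"
  assumes "sets M = sets (restrict_space borel (cball c r))" "h \<in> borel_measurable borel"
  shows "h \<in> borel_measurable M" "{x \<in> space M. h x = b} \<in> sets M"
proof -
  have "h \<in> borel_measurable (restrict_space borel (cball c r))"
    using assms(2) by (rule measurable_restrict_space1)
  then show "h \<in> borel_measurable M"
    using measurable_cong_sets[OF assms(1) refl] by blast
  then show "{x \<in> space M. h x = b} \<in> sets M" by measurable
qed

lemma AE_not_level_set:
  fixes h :: "real ^ 'm \<Rightarrow> real"
  assumes sets: "sets M = sets (restrict_space borel (cball c r))" and h: "h \<in> borel_measurable borel"
    and null: "null_on_lebesgue_null M" and neg: "negligible {x. h x = b}"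
  shows "AE x in M. h x \<noteq> b"
proof -
  let ?A = "{x \<in> space M. h x = b}"
  have "?A \<in> sets M" by (rule measurable_restrict_cball[OF sets h])
  moreover have "?A \<in> null_sets lebesgue"
    using negligible_subset[OF neg, of ?A] by (auto simp: negligible_iff_null_sets)
  ultimately have "?A \<in> null_sets M" using null by (auto simp: null_on_lebesgue_null_def)
  then show ?thesis by (rule AE_I') auto
qed

text \<open>With all other coordinates frozen, a coincidence confines \<open>\<omega> p\<close> to a
  single point.\<close>

lemma AE_PiM_neq:
  fixes M :: "'i \<Rightarrow> (real ^ 'm) measure"
  assumes fin: "finite I" and prob: "\<And>p. p \<in> I \<Longrightarrow> prob_space (M p)"
    and sets: "\<And>p. p \<in> I \<Longrightarrow> sets (M p) = sets (restrict_space borel (cball (c p) (r p)))"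
    and null: "\<And>p. p \<in> I \<Longrightarrow> null_on_lebesgue_null (M p)"
    and pq: "p \<in> I" "q \<in> I" "p \<noteq> q"
  shows "AE \<omega> in PiM I M. \<omega> p \<noteq> \<omega> q"
proof (rule AE_PiM_if_AE_component[OF fin pq(1) prob])
  have "(\<lambda>\<omega>. \<omega> p) \<in> borel_measurable (PiM I M)" "(\<lambda>\<omega>. \<omega> q) \<in> borel_measurable (PiM I M)"
    using borel_measurable_PiM_component[of I M "\<lambda>p. cball (c p) (r p)", OF sets] pq by auto
  then have "(\<lambda>\<omega>. dist (\<omega> p) (\<omega> q)) \<in> borel_measurable (PiM I M)"
    by (rule borel_measurable_dist)
  from borel_measurable_eq[OF this borel_measurable_const[of 0]]
  show "{\<omega> \<in> space (PiM I M). \<not> \<omega> p \<noteq> \<omega> q} \<in> sets (PiM I M)" by simp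
next
  fix \<omega> assume "\<omega> \<in> space (PiM (I - {p}) M)"
  have "AE x in M p. dist x (\<omega> q) \<noteq> 0"
    using sets[OF pq(1)] _ null[OF pq(1)]
    by (rule AE_not_level_set) (auto simp: negligible_sing)
  then show "AE x in M p. fun_upd \<omega> p x p \<noteq> fun_upd \<omega> p x q"
    using pq by simp
qed

text \<open>Both sums contain the distance between the two points. Once it is cancelled, the right
  side no longer depends on \<open>\<omega> p\<close>, so a tie confines \<open>\<omega> p\<close>
  to a level set of a sum of distances. A third index keeps this sum nonempty; with two points the
  sums always agree.\<close>

lemma AE_PiM_sum_dist_neq:
  fixes M :: "'i \<Rightarrow> (real ^ 'm) measure"
  assumes dim: "2 \<le> CARD('m)"
    and fin: "finite I" and prob: "\<And>p. p \<in> I \<Longrightarrow> prob_space (M p)"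
    and sets: "\<And>p. p \<in> I \<Longrightarrow> sets (M p) = sets (restrict_space borel (cball (c p) (r p)))"
    and null: "\<And>p. p \<in> I \<Longrightarrow> null_on_lebesgue_null (M p)"
    and J: "J \<subseteq> I" "3 \<le> card J" and pq: "p \<in> J" "q \<in> J" "p \<noteq> q"
  shows "AE \<omega> in PiM I M. (\<Sum>l\<in>J. dist (\<omega> p) (\<omega> l)) \<noteq> (\<Sum>l\<in>J. dist (\<omega> q) (\<omega> l))"
proof (rule AE_PiM_if_AE_component[OF fin _ prob])
  show "p \<in> I" using J pq by blast
  have "(\<lambda>\<omega>. \<omega> l) \<in> borel_measurable (PiM I M)" if "l \<in> J" for l
    using borel_measurable_PiM_component[of I M "\<lambda>p. cball (c p) (r p)", OF sets] that J by auto
  then have "(\<lambda>\<omega>. \<Sum>l\<in>J. dist (\<omega> j) (\<omega> l)) \<in> borel_measurable (PiM I M)" if "j \<in> J" for j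
    using that by (intro borel_measurable_sum borel_measurable_dist) auto
  from borel_measurable_eq[OF this[OF pq(1)] this[OF pq(2)]]
  show "{\<omega> \<in> space (PiM I M). \<not> (\<Sum>l\<in>J. dist (\<omega> p) (\<omega> l)) \<noteq> (\<Sum>l\<in>J. dist (\<omega> q) (\<omega> l))} \<in> sets (PiM I M)"
    by simp
next
  fix \<omega> assume "\<omega> \<in> space (PiM (I - {p}) M)"
  define Q where "Q = J - {p, q}"
  have finJ: "finite J" using fin J finite_subset by blast
  have Q: "finite Q" "p \<notin> Q" "q \<notin> Q" "J = insert p (insert q Q)" using finJ pq by (auto simp: Q_def)
  have "Q \<noteq> {}" using J(2) pq Q by auto
  then have neg: "negligible {x. (\<Sum>l\<in>Q. dist x (\<omega> l)) = (\<Sum>l\<in>Q. dist (\<omega> q) (\<omega> l))}"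
    using dim Q by (intro negligible_sum_dist_level_set) auto
  have "AE x in M p. (\<Sum>l\<in>Q. dist x (\<omega> l)) \<noteq> (\<Sum>l\<in>Q. dist (\<omega> q) (\<omega> l))"
    using sets _ null neg \<open>J \<subseteq> I\<close> pq by (intro AE_not_level_set) auto
  moreover have "(\<Sum>l\<in>Q. dist y (fun_upd \<omega> p x l)) = (\<Sum>l\<in>Q. dist y (\<omega> l))" for x y
    using Q by (intro sum.cong) auto
  ultimately show "AE x in M p. (\<Sum>l\<in>J. dist (fun_upd \<omega> p x p) (fun_upd \<omega> p x l))
      \<noteq> (\<Sum>l\<in>J. dist (fun_upd \<omega> p x q) (fun_upd \<omega> p x l))"
    using Q pq by (simp add: dist_commute)
qed

section \<open>Concentration of averages\<close>

text \<open>Hoeffding's inequality for the block \<open>J\<close> of identically distributed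
  coordinates. The values lie in an interval of length \<open>2 * B\<close>, whose square turns the
  factor 2 in the exponent into \<open>1 / (2 * B\<^sup>2)\<close>.\<close>

lemma prob_average_deviation_le:
  fixes M :: "'i \<Rightarrow> 'a measure" and \<epsilon> B :: real
  assumes fin: "finite I" and prob: "\<And>p. p \<in> I \<Longrightarrow> prob_space (M p)"
    and J: "J \<subseteq> I" "J \<noteq> {}" "\<And>p. p \<in> J \<Longrightarrow> M p = N"
    and f: "(f :: 'a \<Rightarrow> real) \<in> borel_measurable N" "\<And>x. x \<in> space N \<Longrightarrow> \<bar>f x\<bar> \<le> B" "0 < B"
    and \<epsilon>: "0 < \<epsilon>"
  shows "measure (PiM I M) {\<omega> \<in> space (PiM I M). \<epsilon> * card J \<le> \<bar>(\<Sum>p\<in>J. f (\<omega> p)) - card J * integral\<^sup>L N f\<bar>}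
    \<le> 2 * exp (- (\<epsilon>\<^sup>2 / (2 * B\<^sup>2)) * card J)"
proof -
  have finJ: "finite J" using fin J finite_subset by blast
  interpret prob_space "PiM I M" using prob by (rule prob_space_PiM)
  have comp: "(\<lambda>\<omega>. \<omega> p) \<in> measurable (PiM I M) N" if "p \<in> J" for p
    using measurable_component_singleton[of p I M] that J by auto
  have distr: "distr (PiM I M) N (\<lambda>\<omega>. \<omega> p) = N" if "p \<in> J" for p
    using distr_PiM_component[of I M p, OF prob] that J by auto
  have X: "(\<lambda>\<omega>. f (\<omega> p)) \<in> borel_measurable (PiM I M)" if "p \<in> J" for p
    using comp[OF that] f(1) by (rule measurable_compose)
  have "indep_vars M (\<lambda>p \<omega>. \<omega> p) I"
  proof (subst indep_vars_iff_distr_eq_PiM')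
    show "I \<noteq> {}" using J by auto
    show "random_variable (M p) (\<lambda>\<omega>. \<omega> p)" if "p \<in> I" for p
      using that by (rule measurable_component_singleton)
    have "distr (PiM I M) (PiM I M) (\<lambda>\<omega>. \<lambda>p\<in>I. \<omega> p) = distr (PiM I M) (PiM I M) (\<lambda>\<omega>. \<omega>)"
      by (intro distr_cong refl) (auto simp: space_PiM PiE_restrict)
    also have "\<dots> = PiM I M" by (rule distr_id2) simp
    also have "\<dots> = PiM I (\<lambda>p. distr (PiM I M) (M p) (\<lambda>\<omega>. \<omega> p))"
      using distr_PiM_component[of I M, OF prob] by (intro PiM_cong refl) auto
    finally show "distr (PiM I M) (PiM I M) (\<lambda>\<omega>. \<lambda>p\<in>I. \<omega> p) = PiM I (\<lambda>p. distr (PiM I M) (M p) (\<lambda>\<omega>. \<omega> p))" .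
  qed
  then have "indep_vars M (\<lambda>p \<omega>. \<omega> p) J" using J(1) by (rule indep_vars_subset)
  then have indep: "indep_vars (\<lambda>_. borel) (\<lambda>p \<omega>. f (\<omega> p)) J"
    by (rule indep_vars_compose2) (use f J in auto)
  obtain p0 where p0: "p0 \<in> J" using J by blast
  have dX: "distr (PiM I M) borel (\<lambda>\<omega>. f (\<omega> p)) = distr N borel f" if "p \<in> J" for p
  proof -
    have "distr N borel f = distr (distr (PiM I M) N (\<lambda>\<omega>. \<omega> p)) borel f" using distr[OF that] by simp
    also have "\<dots> = distr (PiM I M) borel (f \<circ> (\<lambda>\<omega>. \<omega> p))"
      using f(1) comp[OF that] by (rule distr_distr)
    finally show ?thesis by (simp add: comp_def)
  qed
  have E: "expectation (\<lambda>\<omega>. f (\<omega> p0)) = integral\<^sup>L N f"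
    using integral_distr[OF comp[OF p0] f(1)] distr[OF p0] by simp
  interpret Hoeffding_ineq_iid "PiM I M" J "\<lambda>p \<omega>. f (\<omega> p)" "\<lambda>\<omega>. f (\<omega> p0)" "- B" B "integral\<^sup>L N f"
  proof unfold_locales
    show "AE \<omega> in PiM I M. f (\<omega> p0) \<in> {- B..B}"
      using f(2) measurable_space[OF comp[OF p0]] by (intro AE_I2) (fastforce simp: abs_le_iff)
  qed (use finJ indep dX p0 X E in auto)
  have n: "0 < card J" using finJ J by (simp add: card_gt_0_iff)
  have "prob {\<omega> \<in> space (PiM I M). \<epsilon> * card J \<le> \<bar>(\<Sum>p\<in>J. f (\<omega> p)) - card J * integral\<^sup>L N f\<bar>}
      \<le> 2 * exp (- 2 * (\<epsilon> * card J)\<^sup>2 / (card J * (B - - B)\<^sup>2))"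
    using f(3) \<epsilon> J by (intro Hoeffding_ineq_abs_ge) auto
  also have "- 2 * (\<epsilon> * card J)\<^sup>2 / (card J * (B - - B)\<^sup>2) = - (\<epsilon>\<^sup>2 / (2 * B\<^sup>2)) * card J"
    using n f(3) by (simp add: field_simps power2_eq_square)
  finally show ?thesis .
qed

text \<open>The step from a net to all points. The three errors come from moving the sample sum from
  \<open>z\<close> to \<open>w\<close>, from the deviation at \<open>w\<close>, and from moving the
  mean back to \<open>z\<close>.\<close>

lemma average_close_if_close_at_neighbour:
  fixes h :: "'z \<Rightarrow> 'x \<Rightarrow> real" and H :: "'z \<Rightarrow> real"
  assumes h: "\<And>x. \<bar>h z x - h w x\<bar> \<le> e" and H: "\<bar>H z - H w\<bar> \<le> e"
    and w: "\<bar>(\<Sum>l\<in>J. h w (X l)) - real (card J) * H w\<bar> \<le> e * real (card J)"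
  shows "\<bar>(\<Sum>l\<in>J. h z (X l)) - real (card J) * H z\<bar> \<le> 3 * e * real (card J)"
proof -
  have "\<bar>\<Sum>l\<in>J. h z (X l) - h w (X l)\<bar> \<le> (\<Sum>l\<in>J. e)"
    by (rule order_trans[OF sum_abs sum_mono]) (rule h)
  then have "\<bar>(\<Sum>l\<in>J. h z (X l)) - (\<Sum>l\<in>J. h w (X l))\<bar> \<le> e * real (card J)"
    by (simp add: sum_subtractf mult.commute)
  moreover have "\<bar>real (card J) * H z - real (card J) * H w\<bar> \<le> e * real (card J)"
    using mult_left_mono[OF H, of "real (card J)"] abs_mult[of "real (card J)" "H z - H w"]
    by (simp add: right_diff_distrib mult.commute[of e])
  ultimately show ?thesis using w by linarith
qed

section \<open>The mean contribution\<close>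

text \<open>\<open>\<gamma>_eq\<close> is the definition of \<open>\<alpha>\<close> solved for
  \<open>\<gamma>\<close>; through it, \<open>r_less_\<alpha>\<close> and
  \<open>\<alpha>_less\<close> are the lower and the upper bound on \<open>\<gamma>\<close>.\<close>

locale separated_balls =
  fixes k :: nat and c :: "nat \<Rightarrow> real ^ 'm" and r \<beta> \<alpha> :: "nat \<Rightarrow> real"
    and \<mu> :: "nat \<Rightarrow> (real ^ 'm) measure" and \<gamma> :: real
  assumes r_pos: "\<And>i. i \<in> {1..k} \<Longrightarrow> 0 < r i"
    and \<beta>_ge_1: "\<And>i. i \<in> {1..k} \<Longrightarrow> 1 \<le> \<beta> i"
    and prob_\<mu>: "\<And>i. i \<in> {1..k} \<Longrightarrow> prob_space (\<mu> i)"
    and sets_\<mu>: "\<And>i. i \<in> {1..k} \<Longrightarrow> sets (\<mu> i) = sets (restrict_space borel (cball (c i) (r i)))"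
    and r_less_\<alpha>: "\<And>i. i \<in> {1..k} \<Longrightarrow> r i < \<alpha> i"
    and \<alpha>_less: "\<And>i j. i \<in> {1..k} \<Longrightarrow> j \<in> {1..k} \<Longrightarrow> i \<noteq> j \<Longrightarrow> \<alpha> j < dist (c i) (c j) - r j"
    and \<gamma>_eq: "\<And>i. i \<in> {1..k} \<Longrightarrow> \<gamma> = \<beta> i * (\<alpha> i - (\<integral>x. dist (c i) x \<partial>\<mu> i))"
begin

abbreviation mean_dist :: "nat \<Rightarrow> real ^ 'm \<Rightarrow> real" where
  "mean_dist i z \<equiv> \<integral>x. dist z x \<partial>\<mu> i"

abbreviation mean_hinge :: "nat \<Rightarrow> real ^ 'm \<Rightarrow> real" where
  "mean_hinge i z \<equiv> \<integral>x. max (\<alpha> i - dist z x) 0 \<partial>\<mu> i"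

lemma space_\<mu>: "i \<in> {1..k} \<Longrightarrow> space (\<mu> i) = cball (c i) (r i)"
  using sets_eq_imp_space_eq[OF sets_\<mu>[of i]] by (simp add: space_restrict_space)

lemma measurable_\<mu>:
  assumes "i \<in> {1..k}" "(h :: real ^ 'm \<Rightarrow> real) \<in> borel_measurable borel"
  shows "h \<in> borel_measurable (\<mu> i)"
  using measurable_restrict_cball(1)[OF sets_\<mu>[OF assms(1)] assms(2)] .

lemma integrable_dist: "i \<in> {1..k} \<Longrightarrow> integrable (\<mu> i) (dist z)"
proof -
  assume i: "i \<in> {1..k}"
  interpret prob_space "\<mu> i" using i by (rule prob_\<mu>)
  show ?thesis
  proof (rule integrable_const_bound[where B = "dist z (c i) + r i"])
    show "AE x in \<mu> i. norm (dist z x) \<le> dist z (c i) + r i"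
    proof (rule AE_I2)
      fix x assume "x \<in> space (\<mu> i)"
      then have "dist (c i) x \<le> r i" by (simp add: space_\<mu>[OF i])
      then show "norm (dist z x) \<le> dist z (c i) + r i"
        using dist_triangle[of z x "c i"] by simp
    qed
  qed (rule measurable_\<mu>[OF i], measurable)
qed

lemma integrable_hinge: "i \<in> {1..k} \<Longrightarrow> integrable (\<mu> i) (\<lambda>x. max (\<alpha> i - dist z x) 0)"
proof -
  assume i: "i \<in> {1..k}"
  interpret prob_space "\<mu> i" using i by (rule prob_\<mu>)
  show ?thesis using integrable_dist[OF i] by (intro integrable_max) auto
qed

lemma abs_integral_diff_le:
  assumes i: "i \<in> {1..k}" and int: "integrable (\<mu> i) f" "integrable (\<mu> i) g"
    and le: "\<And>x. \<bar>f x - g x\<bar> \<le> (b :: real)"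
  shows "\<bar>(\<integral>x. f x \<partial>\<mu> i) - (\<integral>x. g x \<partial>\<mu> i)\<bar> \<le> b"
proof -
  interpret prob_space "\<mu> i" using i by (rule prob_\<mu>)
  have "(\<integral>x. f x \<partial>\<mu> i) - (\<integral>x. g x \<partial>\<mu> i) = (\<integral>x. f x - g x \<partial>\<mu> i)"
    using int by simp
  moreover have "(\<integral>x. f x - g x \<partial>\<mu> i) \<le> b"
    using int le by (intro integral_le_const AE_I2) (auto simp: abs_le_iff)
  moreover have "- b \<le> (\<integral>x. f x - g x \<partial>\<mu> i)"
  proof (intro integral_ge_const AE_I2)
    show "- b \<le> f x - g x" for x using le[of x] by linarith
  qed (use int in auto)
  ultimately show ?thesis by (simp add: abs_le_iff)
qed

lemma mean_dist_lipschitz: "i \<in> {1..k} \<Longrightarrow> \<bar>mean_dist i z - mean_dist i w\<bar> \<le> dist z w"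
proof (intro abs_integral_diff_le integrable_dist)
  show "\<bar>dist z x - dist w x\<bar> \<le> dist z w" for x
    using abs_dist_diff_le[of z x w] by (simp add: dist_commute[of x w])
qed

lemma mean_hinge_lipschitz: "i \<in> {1..k} \<Longrightarrow> \<bar>mean_hinge i z - mean_hinge i w\<bar> \<le> dist z w"
proof (intro abs_integral_diff_le integrable_hinge)
  show "\<bar>max (\<alpha> i - dist z x) 0 - max (\<alpha> i - dist w x) 0\<bar> \<le> dist z w" for x
    using abs_dist_diff_le[of z x w] unfolding dist_commute[of x w] by linarith
qed

lemma mean_dist_convex:
  assumes i: "i \<in> {1..k}" and uv: "0 \<le> u" "0 \<le> v" "u + v = 1"
  shows "mean_dist i (u *\<^sub>R w + v *\<^sub>R z) \<le> u * mean_dist i w + v * mean_dist i z"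
proof -
  have "mean_dist i (u *\<^sub>R w + v *\<^sub>R z) \<le> (\<integral>x. u * dist w x + v * dist z x \<partial>\<mu> i)"
  proof (intro integral_mono)
    fix x
    show "dist (u *\<^sub>R w + v *\<^sub>R z) x \<le> u * dist w x + v * dist z x"
      using convex_on_dist[of UNIV x] uv unfolding dist_commute[of _ x] by (simp add: convex_on_def)
  qed (use integrable_dist[OF i] in auto)
  also have "\<dots> = u * mean_dist i w + v * mean_dist i z"
    using integrable_dist[OF i] by simp
  finally show ?thesis .
qed

text \<open>Finitely many strict inequalities leave a common margin. The factor 2 reserves one
  \<open>\<epsilon>\<close> for the distance of a point from its center and one for replacing
  \<open>\<alpha>\<close> by the dual values of the sample. The element 1 makes \<open>A\<close>
  nonempty even for \<open>k = 0\<close>.\<close>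

lemma near_far_eps:
  obtains \<epsilon> where "0 < \<epsilon>" "\<And>i. i \<in> {1..k} \<Longrightarrow> r i + 2 * \<epsilon> < \<alpha> i"
    "\<And>i j. i \<in> {1..k} \<Longrightarrow> j \<in> {1..k} \<Longrightarrow> i \<noteq> j \<Longrightarrow> \<alpha> j + 2 * \<epsilon> < dist (c i) (c j) - r j"
proof -
  define A where "A = insert 1 ((\<lambda>i. \<alpha> i - r i) ` {1..k} \<union>
    (\<lambda>(i, j). dist (c i) (c j) - r j - \<alpha> j) ` {p \<in> {1..k} \<times> {1..k}. fst p \<noteq> snd p})"
  have fin: "finite A" by (simp add: A_def)
  have pos: "0 < Min A"
    using fin r_less_\<alpha> \<alpha>_less by (subst Min_gr_iff) (fastforce simp: A_def)+
  show thesis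
  proof
    show "0 < Min A / 3" using pos by simp
    show "r i + 2 * (Min A / 3) < \<alpha> i" if "i \<in> {1..k}" for i
    proof -
      have "Min A \<le> \<alpha> i - r i" using fin that by (intro Min_le) (auto simp: A_def)
      then show ?thesis using pos by linarith
    qed
    show "\<alpha> j + 2 * (Min A / 3) < dist (c i) (c j) - r j" if "i \<in> {1..k}" "j \<in> {1..k}" "i \<noteq> j" for i j
    proof -
      have "Min A \<le> dist (c i) (c j) - r j - \<alpha> j" using fin that by (intro Min_le) (force simp: A_def)+
      then show ?thesis using pos by linarith
    qed
  qed
qed

lemma continuous_mean_contribution: "continuous_on UNIV (mean_contribution k \<mu> \<beta> \<alpha>)"
proof -
  have "continuous_on UNIV (mean_hinge i)" if "i \<in> {1..k}" for i
  proof -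
    have "1-lipschitz_on UNIV (mean_hinge i)"
      using mean_hinge_lipschitz[OF that] by (intro lipschitz_onI) (auto simp: dist_real_def)
    then show ?thesis by (rule lipschitz_on_continuous_on)
  qed
  then show ?thesis
    unfolding mean_contribution_def by (intro continuous_intros)
qed

lemma mean_contribution_near_center:
  assumes i: "i \<in> {1..k}" and z: "dist z (c i) < \<epsilon>" and "r i + \<epsilon> < \<alpha> i"
    and far: "\<And>j. j \<in> {1..k} \<Longrightarrow> i \<noteq> j \<Longrightarrow> \<alpha> j + \<epsilon> < dist (c i) (c j) - r j"
  shows "mean_contribution k \<mu> \<beta> \<alpha> z = \<beta> i * (\<alpha> i - mean_dist i z)"
proof -
  interpret prob_space "\<mu> i" using i by (rule prob_\<mu>)
  have own: "mean_hinge i z = \<alpha> i - mean_dist i z"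
  proof -
    have "mean_hinge i z = (\<integral>x. \<alpha> i - dist z x \<partial>\<mu> i)"
    proof (intro Bochner_Integration.integral_cong refl)
      fix x assume "x \<in> space (\<mu> i)"
      then have "dist (c i) x \<le> r i" by (simp add: space_\<mu>[OF i])
      then show "max (\<alpha> i - dist z x) 0 = \<alpha> i - dist z x"
        using dist_triangle[of z x "c i"] z assms(3) by simp
    qed
    also have "\<dots> = \<alpha> i - mean_dist i z" using integrable_dist[OF i] by (simp add: prob_space)
    finally show ?thesis .
  qed
  have other: "mean_hinge j z = 0" if j: "j \<in> {1..k}" "i \<noteq> j" for j
  proof -
    have "mean_hinge j z = (\<integral>x. 0 \<partial>\<mu> j)"
    proof (intro Bochner_Integration.integral_cong refl)
      fix x assume "x \<in> space (\<mu> j)"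
      then have "dist (c j) x \<le> r j" by (simp add: space_\<mu>[OF j(1)])
      then show "max (\<alpha> j - dist z x) 0 = 0"
        using dist_triangle[of "c i" "c j" x] dist_triangle[of "c i" x z] z far[OF j]
        by (simp add: dist_commute)
    qed
    then show ?thesis by simp
  qed
  have "mean_contribution k \<mu> \<beta> \<alpha> z = (\<Sum>j\<in>{1..k}. if j = i then \<beta> i * (\<alpha> i - mean_dist i z) else 0)"
    unfolding mean_contribution_def using own other by (intro sum.cong) auto
  then show ?thesis using i by simp
qed

text \<open>This is the purpose of the choice of \<open>\<alpha>\<close>: all centers get the same
  value, so that \<open>n * \<gamma>\<close> can serve as the single multiplier \<open>u\<close> of
  the constraint on the number of centers.\<close>

lemma mean_contribution_center:
  assumes "i \<in> {1..k}"
  shows "mean_contribution k \<mu> \<beta> \<alpha> (c i) = \<gamma>"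
proof -
  obtain \<epsilon> where \<epsilon>: "0 < \<epsilon>" "\<And>i. i \<in> {1..k} \<Longrightarrow> r i + 2 * \<epsilon> < \<alpha> i"
    "\<And>i j. i \<in> {1..k} \<Longrightarrow> j \<in> {1..k} \<Longrightarrow> i \<noteq> j \<Longrightarrow> \<alpha> j + 2 * \<epsilon> < dist (c i) (c j) - r j"
    using near_far_eps by blast
  have "mean_contribution k \<mu> \<beta> \<alpha> (c i) = \<beta> i * (\<alpha> i - mean_dist i (c i))"
    using assms \<epsilon> by (intro mean_contribution_near_center[where \<epsilon> = "2 * \<epsilon>"]) auto
  then show ?thesis using \<gamma>_eq[OF assms] by simp
qed

end

locale center_optimal = separated_balls k c r \<beta> \<alpha> \<mu> \<gamma>
  for k :: nat and c :: "nat \<Rightarrow> real ^ 'm" and r \<beta> \<alpha> :: "nat \<Rightarrow> real"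
    and \<mu> :: "nat \<Rightarrow> (real ^ 'm) measure" and \<gamma> :: real +
  assumes mean_contribution_less: "\<And>i z. i \<in> {1..k} \<Longrightarrow> z \<in> cball (c i) (r i) \<Longrightarrow> z \<noteq> c i
      \<Longrightarrow> mean_contribution k \<mu> \<beta> \<alpha> z < \<gamma>"
begin

text \<open>Locally this is the optimality of the center for the contribution, and convexity makes it
  global.\<close>

lemma mean_dist_ge:
  assumes i: "i \<in> {1..k}" and z: "z \<in> cball (c i) (r i)"
  shows "mean_dist i (c i) \<le> mean_dist i z"
proof (cases "z = c i")
  case False
  obtain \<epsilon> where \<epsilon>: "0 < \<epsilon>" "\<And>i. i \<in> {1..k} \<Longrightarrow> r i + 2 * \<epsilon> < \<alpha> i"
    "\<And>i j. i \<in> {1..k} \<Longrightarrow> j \<in> {1..k} \<Longrightarrow> i \<noteq> j \<Longrightarrow> \<alpha> j + 2 * \<epsilon> < dist (c i) (c j) - r j"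
    using near_far_eps by blast
  \<comment> \<open>The point \<open>w\<close> on the segment from the center to \<open>z\<close>
    has to be close enough for \<open>mean_contribution_near_center\<close>;
    \<open>t \<le> 1\<close> keeps it in the ball.\<close>
  define t where "t = min 1 (\<epsilon> / dist z (c i))"
  have t: "0 < t" "t \<le> 1" "t * dist z (c i) \<le> \<epsilon>"
    using \<epsilon>(1) False by (auto simp: t_def min_def field_simps)
  define w where "w = (1 - t) *\<^sub>R c i + t *\<^sub>R z"
  have "w - c i = t *\<^sub>R (z - c i)" by (simp add: w_def algebra_simps)
  then have dw: "dist w (c i) = t * dist z (c i)" using t by (simp add: dist_norm)
  have "w \<noteq> c i" using dw t False by auto
  moreover have "w \<in> cball (c i) (r i)"
    using dw t z mult_right_mono[of t 1 "dist z (c i)"] by (simp add: dist_commute)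
  ultimately have "mean_contribution k \<mu> \<beta> \<alpha> w < \<gamma>" using i by (intro mean_contribution_less)
  also have "mean_contribution k \<mu> \<beta> \<alpha> w = \<beta> i * (\<alpha> i - mean_dist i w)"
    using i \<epsilon> dw t by (intro mean_contribution_near_center[where \<epsilon> = "2 * \<epsilon>"]) auto
  also have "\<gamma> = \<beta> i * (\<alpha> i - mean_dist i (c i))" using i by (rule \<gamma>_eq)
  finally have "mean_dist i (c i) < mean_dist i w" using \<beta>_ge_1[OF i] by simp
  also have "\<dots> \<le> (1 - t) * mean_dist i (c i) + t * mean_dist i z"
    unfolding w_def using i t by (intro mean_dist_convex) auto
  finally have "t * mean_dist i (c i) < t * mean_dist i z" by (simp add: algebra_simps)
  then show ?thesis using t by simp
qed simp

text \<open>A continuous function that is below \<open>\<gamma>\<close> on a compact set stays below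
  it by a fixed amount. The set is empty when \<open>\<epsilon>\<close> exceeds all radii, and then
  any \<open>\<theta>\<close> serves.\<close>

lemma contribution_gap:
  assumes "0 < \<epsilon>"
  obtains \<theta> where "0 < \<theta>" "\<And>i z. i \<in> {1..k} \<Longrightarrow> z \<in> cball (c i) (r i) \<Longrightarrow> \<epsilon> \<le> dist z (c i)
    \<Longrightarrow> mean_contribution k \<mu> \<beta> \<alpha> z \<le> \<gamma> - \<theta>"
proof -
  let ?G = "mean_contribution k \<mu> \<beta> \<alpha>"
  define K where "K = (\<Union>i\<in>{1..k}. cball (c i) (r i) - ball (c i) \<epsilon>)"
  have K: "compact K" unfolding K_def by (intro compact_UN compact_diff) auto
  have less: "?G z < \<gamma>" if "z \<in> K" for z
    using that assms mean_contribution_less unfolding K_def by fastforce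
  show thesis
  proof (cases "K = {}")
    case True
    show ?thesis
    proof
      show "(0::real) < 1" by simp
      show "?G z \<le> \<gamma> - 1" if "i \<in> {1..k}" "z \<in> cball (c i) (r i)" "\<epsilon> \<le> dist z (c i)" for i z
        using True that by (force simp: K_def dist_commute)
    qed
  next
    case False
    obtain x where x: "x \<in> K" "\<And>z. z \<in> K \<Longrightarrow> ?G z \<le> ?G x"
      using continuous_attains_sup[OF K False] continuous_on_subset[OF continuous_mean_contribution]
      by blast
    show ?thesis
    proof
      show "0 < \<gamma> - ?G x" using less[OF x(1)] by simp
      show "?G z \<le> \<gamma> - (\<gamma> - ?G x)" if "i \<in> {1..k}" "z \<in> cball (c i) (r i)" "\<epsilon> \<le> dist z (c i)" for i z
      proof -
        have "z \<in> K" using that by (auto simp: K_def dist_commute)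
        then show ?thesis using x(2) by simp
      qed
    qed
  qed
qed

section \<open>Recovery of the balls\<close>

text \<open>The deterministic part: all that is asked of the sample is in the hypotheses. The error
  budget is as follows. \<open>a\<close> differs from \<open>\<alpha>\<close> by at most
  \<open>2 * \<tau>\<close>, one \<open>\<tau>\<close> for the sample average and one for the
  distance of a central sample point from the center. The sums of hinges at a far point add another
  \<open>\<tau>\<close> per draw. Over all balls this is
  \<open>3 * \<tau> * (\<Sum>i\<in>{1..k}. \<beta> i)\<close> after division by \<open>n\<close>,
  which the gap \<open>\<theta>\<close> exceeds.\<close>

lemma exact_recovery_if_concentrated:
  fixes n :: nat and \<omega> :: "nat \<times> nat \<Rightarrow> real ^ 'm"
  defines "N \<equiv> num_draws \<beta> n"
  defines "S \<equiv> drawn_points \<beta> n \<omega>"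
  assumes n: "0 < n" and N: "\<And>i. i \<in> {1..k} \<Longrightarrow> real (N i) = \<beta> i * real n"
    and eps: "0 < \<epsilon>" "\<And>i. i \<in> {1..k} \<Longrightarrow> r i + 2 * \<epsilon> < \<alpha> i"
    "\<And>i j. i \<in> {1..k} \<Longrightarrow> j \<in> {1..k} \<Longrightarrow> i \<noteq> j \<Longrightarrow> \<alpha> j + 2 * \<epsilon> < dist (c i) (c j) - r j"
    and gap: "\<And>i z. i \<in> {1..k} \<Longrightarrow> z \<in> cball (c i) (r i) \<Longrightarrow> \<epsilon> \<le> dist z (c i)
      \<Longrightarrow> mean_contribution k \<mu> \<beta> \<alpha> z \<le> \<gamma> - \<theta>"
    and \<tau>: "2 * \<tau> \<le> \<epsilon>" "3 * \<tau> * (\<Sum>i\<in>{1..k}. \<beta> i) < \<theta>"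
    and mem: "\<And>i l. i \<in> {1..k} \<Longrightarrow> l \<in> {1..N i} \<Longrightarrow> \<omega> (i, l) \<in> cball (c i) (r i)"
    and inj: "inj_on \<omega> (SIGMA i:{1..k}. {1..N i})"
    and dist_close: "\<And>i j z. i \<in> {1..k} \<Longrightarrow> j \<in> {1..k} \<Longrightarrow> z \<in> cball (c j) (r j) \<Longrightarrow>
      \<bar>(\<Sum>l\<in>{1..N i}. dist z (\<omega> (i, l))) - real (N i) * mean_dist i z\<bar> \<le> \<tau> * real (N i)"
    and hinge_close: "\<And>i j z. i \<in> {1..k} \<Longrightarrow> j \<in> {1..k} \<Longrightarrow> z \<in> cball (c j) (r j) \<Longrightarrow>
      \<bar>(\<Sum>l\<in>{1..N i}. max (\<alpha> i - dist z (\<omega> (i, l))) 0) - real (N i) * mean_hinge i z\<bar> \<le> \<tau> * real (N i)"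
    and central: "\<And>i. i \<in> {1..k} \<Longrightarrow> \<exists>l\<in>{1..N i}. dist (\<omega> (i, l)) (c i) \<le> \<tau>"
    and unique: "\<And>i p p'. i \<in> {1..k} \<Longrightarrow> p \<in> S i \<Longrightarrow> p' \<in> S i \<Longrightarrow>
      (\<And>x. x \<in> S i \<Longrightarrow> (\<Sum>q\<in>S i. dist p q) \<le> (\<Sum>q\<in>S i. dist x q)) \<Longrightarrow>
      (\<And>x. x \<in> S i \<Longrightarrow> (\<Sum>q\<in>S i. dist p' q) \<le> (\<Sum>q\<in>S i. dist x q)) \<Longrightarrow> p = p'"
  shows "exact_recovery k S"
proof -
  have \<beta>_pos: "0 < \<beta> i" if "i \<in> {1..k}" for i using \<beta>_ge_1[OF that] by simp
  have N_pos: "0 < real (N i)" if "i \<in> {1..k}" for i using N[OF that] \<beta>_pos[OF that] n by simp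
  have S: "S i = (\<lambda>l. \<omega> (i, l)) ` {1..N i}" for i by (simp add: S_def N_def drawn_points_def)
  have fin: "finite (S i)" for i by (simp add: S)
  have ne: "S i \<noteq> {}" if "i \<in> {1..k}" for i using central[OF that] by (auto simp: S)
  have S_ball: "S i \<subseteq> cball (c i) (r i)" if "i \<in> {1..k}" for i using mem[OF that] by (auto simp: S)
  have inj_i: "inj_on (\<lambda>l. \<omega> (i, l)) {1..N i}" if "i \<in> {1..k}" for i
  proof (rule inj_onI)
    fix l l' assume "l \<in> {1..N i}" "l' \<in> {1..N i}" "\<omega> (i, l) = \<omega> (i, l')"
    with inj_onD[OF inj, of "(i, l)" "(i, l')"] that show "l = l'" by simp
  qed
  have sum_S: "(\<Sum>q\<in>S i. g q) = (\<Sum>l\<in>{1..N i}. g (\<omega> (i, l)))" if "i \<in> {1..k}" for i and g :: "real ^ 'm \<Rightarrow> real"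
    unfolding S sum.reindex[OF inj_i[OF that]] by simp
  have card_S: "card (S i) = N i" if "i \<in> {1..k}" for i
    unfolding S card_image[OF inj_i[OF that]] by simp
  have disj: "S i \<inter> S j = {}" if "i \<in> {1..k}" "j \<in> {1..k}" "i \<noteq> j" for i j
  proof -
    have False if "l \<in> {1..N i}" "l' \<in> {1..N j}" "\<omega> (i, l) = \<omega> (j, l')" for l l'
      using inj_onD[OF inj that(3)] that(1,2) \<open>i \<in> {1..k}\<close> \<open>j \<in> {1..k}\<close> \<open>i \<noteq> j\<close> by simp
    then show ?thesis unfolding S by blast
  qed
  define f where "f i z = (\<Sum>q\<in>S i. dist z q)" for i z
  have "\<exists>m\<in>S i. \<forall>x\<in>S i. f i m \<le> f i x" if "i \<in> {1..k}" for i
    using ex_is_arg_min_if_finite[OF fin ne[OF that], of "f i"] by (auto simp: is_arg_min_linorder)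
  then obtain m where m: "\<And>i. i \<in> {1..k} \<Longrightarrow> m i \<in> S i"
    and m_le: "\<And>i x. i \<in> {1..k} \<Longrightarrow> x \<in> S i \<Longrightarrow> f i (m i) \<le> f i x"
    by metis
  have m_less: "f i (m i) < f i p" if "i \<in> {1..k}" "p \<in> S i" "p \<noteq> m i" for i p
  proof (rule ccontr)
    assume "\<not> ?thesis"
    then have "f i p \<le> f i x" if "x \<in> S i" for x
      using m_le[OF \<open>i \<in> {1..k}\<close> that] by linarith
    then have "p = m i"
      using m_le[OF that(1)] m[OF that(1)] that(1,2) by (intro unique) (auto simp: f_def)
    then show False using that by simp
  qed
  define e where "e i = f i (m i) / real (N i)" for i
  define a where "a i = e i + \<gamma> / \<beta> i" for i
  have \<alpha>_eq: "\<alpha> i = mean_dist i (c i) + \<gamma> / \<beta> i" if "i \<in> {1..k}" for i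
    using \<gamma>_eq[OF that] \<beta>_pos[OF that] by (simp add: field_simps)
  have a_close: "\<bar>a i - \<alpha> i\<bar> \<le> 2 * \<tau>" if i: "i \<in> {1..k}" for i
  proof -
    have f: "\<bar>f i z - real (N i) * mean_dist i z\<bar> \<le> \<tau> * real (N i)" if "z \<in> S i" for z
      using dist_close[OF i i, of z] S_ball[OF i] that by (auto simp: f_def sum_S[OF i])
    \<comment> \<open>By \<open>mean_dist_ge\<close> no point of the ball has a mean distance below
      that of the center, wherever \<open>m i\<close> lies.\<close>
    have "real (N i) * (mean_dist i (c i) - \<tau>) \<le> real (N i) * (mean_dist i (m i) - \<tau>)"
      using mean_dist_ge[OF i, of "m i"] S_ball[OF i] m[OF i] by (intro mult_left_mono) auto
    also have "\<dots> \<le> f i (m i)"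
      using f[OF m[OF i]] by (simp add: algebra_simps abs_le_iff)
    finally have lower: "mean_dist i (c i) - \<tau> \<le> e i"
      using N_pos[OF i] by (simp add: e_def field_simps)
    \<comment> \<open>The minimizer is not yet known to be near the center. For the upper bound it
      suffices to compare it with a sample point that is.\<close>
    obtain l where l: "l \<in> {1..N i}" "dist (\<omega> (i, l)) (c i) \<le> \<tau>" using central[OF i] by blast
    have p0: "\<omega> (i, l) \<in> S i" using l(1) by (simp add: S)
    have "f i (m i) \<le> f i (\<omega> (i, l))" by (rule m_le[OF i p0])
    also have "\<dots> \<le> real (N i) * (mean_dist i (\<omega> (i, l)) + \<tau>)"
      using f[OF p0] by (simp add: algebra_simps abs_le_iff)
    also have "\<dots> \<le> real (N i) * (mean_dist i (c i) + 2 * \<tau>)"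
      using mean_dist_lipschitz[OF i, of "\<omega> (i, l)" "c i"] l(2) by (intro mult_left_mono) auto
    finally have upper: "e i \<le> mean_dist i (c i) + 2 * \<tau>"
      using N_pos[OF i] by (simp add: e_def field_simps)
    have "0 \<le> \<tau>" using l(2) zero_le_dist[of "\<omega> (i, l)" "c i"] by linarith
    then show ?thesis using lower upper unfolding a_def \<alpha>_eq[OF i] by (simp add: abs_le_iff)
  qed
  have own: "dist z q < a i" if "i \<in> {1..k}" "dist z (c i) < \<epsilon>" "q \<in> S i" for i z q
  proof -
    have "dist (c i) q \<le> r i" using S_ball[OF that(1)] that(3) by auto
    then show ?thesis
      using dist_triangle[of z q "c i"] that(2) eps(2)[OF that(1)] a_close[OF that(1)] \<tau>(1) by linarith
  qed
  have other: "a j < dist z q" if "i \<in> {1..k}" "j \<in> {1..k}" "i \<noteq> j" "dist z (c i) < \<epsilon>" "q \<in> S j" for i j z q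
  proof -
    have "dist (c j) q \<le> r j" using S_ball[OF that(2)] that(5) by auto
    then show ?thesis
      using dist_triangle[of "c i" "c j" z] dist_triangle[of z "c j" q] that(4) eps(3)[OF that(1,2,3)]
        a_close[OF that(2)] \<tau>(1) by (simp add: dist_commute)
  qed
  define C where "C z = (\<Sum>j\<in>{1..k}. \<Sum>q\<in>S j. max (a j - dist z q) 0)" for z
  have Na: "real (N i) * a i = real n * \<gamma> + f i (m i)" if "i \<in> {1..k}" for i
    using N_pos[OF that] N[OF that] \<beta>_pos[OF that] n by (simp add: a_def e_def field_simps)
  have C_near: "C z = real n * \<gamma> + f i (m i) - f i z" if i: "i \<in> {1..k}" and z: "dist z (c i) < \<epsilon>" for i z
  proof -
    have "(\<Sum>q\<in>S j. max (a j - dist z q) 0) = (if j = i then real (N i) * a i - f i z else 0)"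
      if j: "j \<in> {1..k}" for j
    proof (cases "j = i")
      case True
      have "(\<Sum>q\<in>S i. max (a i - dist z q) 0) = (\<Sum>q\<in>S i. a i - dist z q)"
        using own[OF i z, THEN less_imp_le] by (intro sum.cong refl) (simp add: max_absorb1)
      then show ?thesis using True by (simp add: sum_subtractf card_S[OF i] f_def)
    next
      case False
      have "(\<Sum>q\<in>S j. max (a j - dist z q) 0) = (\<Sum>q\<in>S j. 0)"
        using other[OF i j _ z, THEN less_imp_le] False by (intro sum.cong refl) (simp add: max_absorb2)
      then show ?thesis using False by simp
    qed
    then have "C z = (\<Sum>j\<in>{1..k}. if j = i then real (N i) * a i - f i z else 0)"
      unfolding C_def by (intro sum.cong refl)
    then show ?thesis using i Na[OF i] by simp
  qed
  have C_far: "C z < real n * \<gamma>" if i: "i \<in> {1..k}" and z: "z \<in> S i" "\<epsilon> \<le> dist z (c i)" for i z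
  proof -
    have zb: "z \<in> cball (c i) (r i)" using S_ball[OF i] z(1) by blast
    have "(\<Sum>q\<in>S j. max (a j - dist z q) 0) \<le> real n * (\<beta> j * mean_hinge j z) + real n * (3 * \<tau> * \<beta> j)"
      if j: "j \<in> {1..k}" for j
    proof -
      have "(\<Sum>q\<in>S j. max (a j - dist z q) 0) \<le> (\<Sum>q\<in>S j. 2 * \<tau> + max (\<alpha> j - dist z q) 0)"
      proof (intro sum_mono)
        show "max (a j - dist z q) 0 \<le> 2 * \<tau> + max (\<alpha> j - dist z q) 0" for q
          using a_close[OF j] by linarith
      qed
      also have "\<dots> = 2 * \<tau> * real (N j) + (\<Sum>l\<in>{1..N j}. max (\<alpha> j - dist z (\<omega> (j, l))) 0)"
        by (simp add: sum.distrib card_S[OF j] sum_S[OF j])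
      also have "\<dots> \<le> 2 * \<tau> * real (N j) + (real (N j) * mean_hinge j z + \<tau> * real (N j))"
        using hinge_close[OF j i zb] by (simp add: abs_le_iff)
      also have "\<dots> = real n * (\<beta> j * mean_hinge j z) + real n * (3 * \<tau> * \<beta> j)"
        by (simp add: N[OF j] algebra_simps)
      finally show ?thesis .
    qed
    then have "C z \<le> (\<Sum>j\<in>{1..k}. real n * (\<beta> j * mean_hinge j z) + real n * (3 * \<tau> * \<beta> j))"
      unfolding C_def by (rule sum_mono)
    also have "\<dots> = real n * (mean_contribution k \<mu> \<beta> \<alpha> z + 3 * \<tau> * (\<Sum>j\<in>{1..k}. \<beta> j))"
      by (simp add: mean_contribution_def sum.distrib sum_distrib_left distrib_left)
    also have "\<dots> < real n * \<gamma>"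
      using gap[OF i zb z(2)] \<tau>(2) n by (intro mult_strict_left_mono) auto
    finally show ?thesis .
  qed
  \<comment> \<open>Dropping the truncation and the other balls only lowers the contribution, and
    what remains at \<open>m i\<close> is \<open>n * \<gamma>\<close> by the choice of
    \<open>a i\<close>. So \<open>C_far\<close> excludes a minimizer far from the center.\<close>
  have m_near: "dist (m i) (c i) < \<epsilon>" if i: "i \<in> {1..k}" for i
  proof (rule ccontr)
    assume "\<not> ?thesis"
    then have "C (m i) < real n * \<gamma>" using C_far[OF i m[OF i]] by simp
    moreover have "real n * \<gamma> = (\<Sum>q\<in>S i. a i - dist (m i) q)"
      using Na[OF i] by (simp add: sum_subtractf card_S[OF i] f_def)
    moreover have "\<dots> \<le> (\<Sum>q\<in>S i. max (a i - dist (m i) q) 0)" by (intro sum_mono) simp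
    moreover have "\<dots> \<le> C (m i)"
      unfolding C_def using i by (intro member_le_sum) (auto intro: sum_nonneg)
    ultimately show False by linarith
  qed
  show ?thesis
  proof (rule exact_recovery_if_dual_certificate[where m = m and a = a and u = "real n * \<gamma>"])
    show "dist (m i) q < a i" if "i \<in> {1..k}" "q \<in> S i" for i q
      using own m_near that by blast
    show "a j < dist (m i) q" if "i \<in> {1..k}" "j \<in> {1..k}" "i \<noteq> j" "q \<in> S j" for i j q
      using other m_near that by blast
    show "(\<Sum>j\<in>{1..k}. \<Sum>q\<in>S j. max (a j - dist p q) 0) < real n * \<gamma>"
      if "i \<in> {1..k}" "p \<in> S i" "p \<noteq> m i" for i p
    proof (cases "dist p (c i) < \<epsilon>")
      case True
      then show ?thesis using C_near[OF that(1) True] m_less[OF that] by (simp add: C_def)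
    next
      case False
      then show ?thesis using C_far[OF that(1,2)] by (simp add: C_def)
    qed
    show "(\<Sum>j\<in>{1..k}. \<Sum>q\<in>S j. max (a j - dist (m i) q) 0) = real n * \<gamma>" if "i \<in> {1..k}" for i
      using C_near[OF that m_near[OF that]] by (simp add: C_def)
  qed (use fin disj m in auto)
qed

text \<open>Up to a null set, failure is contained in a union of large deviations whose number does
  not grow with \<open>n\<close>. A finite net gives uniformity over the balls, because distances
  and hinges are 1-Lipschitz in \<open>z\<close>. The null set covers coinciding points and balls
  with two medians.\<close>

lemma exact_recovery_with_high_probability:
  assumes null: "\<And>i. i \<in> {1..k} \<Longrightarrow> null_on_lebesgue_null (\<mu> i)"
    and positive: "\<And>i. i \<in> {1..k} \<Longrightarrow> positive_near_center (\<mu> i) (c i) (r i)"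
  shows "with_high_probability
    {n. (\<forall>i\<in>{1..k}. \<beta> i * real n \<in> \<nat>) \<and>
        (CARD('m) = 1 \<longrightarrow> (\<forall>i\<in>{1..k}. odd (num_draws \<beta> n i)))}
    (\<lambda>n. esbm k \<mu> \<beta> n)
    (\<lambda>n. {\<omega> \<in> space (esbm k \<mu> \<beta> n). exact_recovery k (drawn_points \<beta> n \<omega>)})"
    (is "with_high_probability ?T _ ?A")
proof -

  \<comment> \<open>Margin, gap and accuracy\<close>
  obtain \<epsilon> where \<epsilon>: "0 < \<epsilon>" "\<And>i. i \<in> {1..k} \<Longrightarrow> r i + 2 * \<epsilon> < \<alpha> i"
    "\<And>i j. i \<in> {1..k} \<Longrightarrow> j \<in> {1..k} \<Longrightarrow> i \<noteq> j \<Longrightarrow> \<alpha> j + 2 * \<epsilon> < dist (c i) (c j) - r j"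
    using near_far_eps by blast
  obtain \<theta> where \<theta>: "0 < \<theta>" "\<And>i z. i \<in> {1..k} \<Longrightarrow> z \<in> cball (c i) (r i) \<Longrightarrow> \<epsilon> \<le> dist z (c i)
      \<Longrightarrow> mean_contribution k \<mu> \<beta> \<alpha> z \<le> \<gamma> - \<theta>"
    using contribution_gap[OF \<epsilon>(1)] by blast
  define b where "b = (\<Sum>i\<in>{1..k}. \<beta> i)"
  have b: "0 \<le> b" unfolding b_def using \<beta>_ge_1 by (intro sum_nonneg) (meson order_trans zero_le_one)
  \<comment> \<open>The first bound leaves room for replacing \<open>\<alpha>\<close> by the sample
    values, the second keeps the total error \<open>3 * \<tau> * b\<close> below the gap. Using
    \<open>b + 1\<close> makes this strict and the denominator positive.\<close>
  define \<tau> where "\<tau> = min (\<epsilon> / 2) (\<theta> / (3 * (b + 1)))"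
  have \<tau>: "0 < \<tau>" "2 * \<tau> \<le> \<epsilon>" using \<epsilon>(1) \<theta>(1) b by (auto simp: \<tau>_def)
  have "3 * \<tau> * b < 3 * \<tau> * (b + 1)" using \<tau>(1) by simp
  also have "\<dots> \<le> \<theta>"
  proof -
    have "\<tau> \<le> \<theta> / (3 * (b + 1))" by (simp add: \<tau>_def)
    then show ?thesis using b by (simp add: field_simps)
  qed
  finally have \<tau>b: "3 * \<tau> * (\<Sum>i\<in>{1..k}. \<beta> i) < \<theta>" by (simp add: b_def)

  \<comment> \<open>Finite net and test functions\<close>
  define K where "K = (\<Union>i\<in>{1..k}. cball (c i) (r i))"
  have "compact K" unfolding K_def by (intro compact_UN) auto
  \<comment> \<open>Three errors of \<open>\<tau> / 3\<close> will add up to \<open>\<tau>\<close>.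
    Net points may lie outside the balls, so the bounds below are taken over
    \<open>K \<union> W\<close>.\<close>
  then obtain W where W: "finite W" "K \<subseteq> (\<Union>w\<in>W. ball w (\<tau> / 3))"
    using \<tau>(1) unfolding compact_eq_totally_bounded by (meson divide_pos_pos zero_less_numeral)
  have "bounded (K \<union> W)" using \<open>compact K\<close> W(1) by (simp add: compact_imp_bounded finite_imp_bounded)
  then obtain x0 d where d: "\<And>x. x \<in> K \<union> W \<Longrightarrow> dist x0 x \<le> d"
    unfolding bounded_def by blast
  define s where "s = (\<Sum>i\<in>{1..k}. \<bar>\<alpha> i\<bar>)"
  \<comment> \<open>Each summand serves one kind of test function: \<open>2 * \<bar>d\<bar>\<close>
    bounds distances, \<open>s\<close> bounds hinges, and 1 bounds indicators.\<close>
  define B where "B = 2 * \<bar>d\<bar> + s + 1"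
  have s: "0 \<le> s" "\<And>i. i \<in> {1..k} \<Longrightarrow> \<bar>\<alpha> i\<bar> \<le> s"
    unfolding s_def by (intro sum_nonneg abs_ge_zero) (rule member_le_sum, auto)
  have B: "0 < B" "1 \<le> B" "\<And>i. i \<in> {1..k} \<Longrightarrow> \<bar>\<alpha> i\<bar> \<le> B"
    using s unfolding B_def by fastforce+
  have dist_B: "dist x y \<le> B" if "x \<in> K \<union> W" "y \<in> K \<union> W" for x y
    using d[OF that(1)] d[OF that(2)] dist_triangle[of x y x0] s(1)
    unfolding B_def dist_commute[of x x0] by linarith

  \<comment> \<open>Written as an integral, this is the mean of a test function, so the same
    deviation bound applies to it.\<close>
  define mass :: "nat \<Rightarrow> real" where "mass i = (\<integral>x. indicator (ball (c i) \<tau>) x \<partial>\<mu> i)" for i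
  have mass: "0 < mass i" if i: "i \<in> {1..k}" for i
  proof -
    have "openin (top_of_set (cball (c i) (r i))) (ball (c i) \<tau> \<inter> cball (c i) (r i))"
      by (metis Int_commute open_ball openin_open_Int)
    moreover have "c i \<in> ball (c i) \<tau> \<inter> cball (c i) (r i)" using \<tau>(1) r_pos[OF i] by auto
    ultimately have "0 < measure (\<mu> i) (ball (c i) \<tau> \<inter> cball (c i) (r i))"
      using positive[OF i] by (simp add: positive_near_center_def)
    then show ?thesis by (simp add: mass_def space_\<mu>[OF i])
  qed
  define mass_min where "mass_min = Min (insert 1 (mass ` {1..k}))"
  have mass_min: "0 < mass_min" "\<And>i. i \<in> {1..k} \<Longrightarrow> mass_min \<le> mass i"
  proof -
    show "0 < mass_min" unfolding mass_min_def using mass by (subst Min_gr_iff) auto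
    show "mass_min \<le> mass i" if "i \<in> {1..k}" for i
      unfolding mass_min_def by (rule Min_le) (use that in simp_all)
  qed
  \<comment> \<open>The first bound serves the net; the second keeps deviations below every
    \<open>mass i\<close>, which produces a draw near each center.\<close>
  define \<eta> where "\<eta> = min (\<tau> / 3) (mass_min / 2)"
  have \<eta>: "0 < \<eta>" "\<eta> \<le> \<tau> / 3" using \<tau>(1) mass_min(1) by (auto simp: \<eta>_def)
  have \<eta>_mass: "\<eta> < mass i" if "i \<in> {1..k}" for i
    using mass_min(1) mass_min(2)[OF that] by (simp add: \<eta>_def min_def)

  \<comment> \<open>This set is finite and independent of \<open>n\<close>, so the union bound costs
    only a constant factor \<open>L\<close>.\<close>
  define test where "test i = dist ` W \<union> (\<lambda>w x. max (\<alpha> i - dist w x) 0) ` W \<union> {indicator (ball (c i) \<tau>)}"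
    for i :: nat
  have test_fin: "finite (test i)" for i using W(1) by (simp add: test_def)
  have test_meas: "f \<in> borel_measurable borel" if "f \<in> test i" for f i
    using that by (auto simp: test_def intro!: borel_measurable_indicator)
  have test_bound: "\<bar>f x\<bar> \<le> B" if i: "i \<in> {1..k}" and "f \<in> test i" "x \<in> cball (c i) (r i)" for f i x
  proof -
    have x: "x \<in> K" using that unfolding K_def by blast
    from that(2) consider w where "w \<in> W" "f = dist w"
      | w where "w \<in> W" "f = (\<lambda>x. max (\<alpha> i - dist w x) 0)" | "f = indicator (ball (c i) \<tau>)"
      unfolding test_def by blast
    then show ?thesis
    proof cases
      case 1
      then show ?thesis using dist_B[of w x] x by simp
    next
      case 2
      show ?thesis using B(3)[OF i] zero_le_dist[of w x] unfolding 2(2) by linarith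
    next
      case 3
      then show ?thesis using B(2) by (simp add: indicator_def)
    qed
  qed

  \<comment> \<open>Deviation events and their probabilities\<close>
  define idx where "idx n = (SIGMA i:{1..k}. {1..num_draws \<beta> n i})" for n
  define deviates where "deviates n i f = {\<omega> \<in> space (esbm k \<mu> \<beta> n). \<eta> * real (num_draws \<beta> n i)
      \<le> \<bar>(\<Sum>l\<in>{1..num_draws \<beta> n i}. f (\<omega> (i, l))) - real (num_draws \<beta> n i) * integral\<^sup>L (\<mu> i) f\<bar>}"
    for n i and f :: "real ^ 'm \<Rightarrow> real"
  define q where "q = exp (- (\<eta>\<^sup>2 / (2 * B\<^sup>2)))"
  have q: "0 < q" "q < 1" using \<eta>(1) B(1) by (auto simp: q_def)
  have idx_fst: "fst p \<in> {1..k}" if "p \<in> idx n" for p n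
    using that by (auto simp: idx_def)
  have prob_idx: "prob_space (\<mu> (fst p))" if "p \<in> idx n" for p n
    by (rule prob_\<mu>[OF idx_fst[OF that]])
  have sets_idx: "sets (\<mu> (fst p)) = sets (restrict_space borel (cball (c (fst p)) (r (fst p))))"
    if "p \<in> idx n" for p n
    by (rule sets_\<mu>[OF idx_fst[OF that]])
  have fin_idx: "finite (idx n)" for n by (simp add: idx_def)
  have esbm: "esbm k \<mu> \<beta> n = PiM (idx n) (\<lambda>p. \<mu> (fst p))" for n
    by (simp add: esbm_def idx_def)
  have prob_esbm: "prob_space (esbm k \<mu> \<beta> n)" for n
    unfolding esbm using prob_idx by (rule prob_space_PiM)
  have block: "Pair i ` {1..num_draws \<beta> n i} \<subseteq> idx n" if "i \<in> {1..k}" for n i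
    using that by (auto simp: idx_def)
  have sum_block: "(\<Sum>p\<in>Pair i ` L. g p) = (\<Sum>l\<in>L. g (i, l))" for i :: nat and L :: "nat set" and g :: "nat \<times> nat \<Rightarrow> real"
    by (simp add: sum.reindex inj_on_def)
  have card_block: "card (Pair i ` L) = card L" for i :: nat and L :: "nat set"
    by (simp add: card_image inj_on_def)
  have deviates_meas: "deviates n i f \<in> sets (esbm k \<mu> \<beta> n)" if i: "i \<in> {1..k}" and f: "f \<in> test i" for n i f
  proof -
    have "(\<lambda>\<omega>. f (\<omega> (i, l))) \<in> borel_measurable (esbm k \<mu> \<beta> n)" if "l \<in> {1..num_draws \<beta> n i}" for l
    proof -
      have "(i, l) \<in> idx n" using block[OF i] that by blast
      from measurable_component_singleton[OF this, of "\<lambda>p. \<mu> (fst p)"]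
      have "(\<lambda>\<omega>. \<omega> (i, l)) \<in> measurable (esbm k \<mu> \<beta> n) (\<mu> i)" by (simp add: esbm)
      then show ?thesis by (rule measurable_compose) (rule measurable_\<mu>[OF i test_meas[OF f]])
    qed
    then have "(\<lambda>\<omega>. \<bar>(\<Sum>l\<in>{1..num_draws \<beta> n i}. f (\<omega> (i, l))) - real (num_draws \<beta> n i) * integral\<^sup>L (\<mu> i) f\<bar>)
        \<in> borel_measurable (esbm k \<mu> \<beta> n)"
      by (intro borel_measurable_abs borel_measurable_diff borel_measurable_sum borel_measurable_const)
    from borel_measurable_le[OF borel_measurable_const this] show ?thesis by (simp add: deviates_def)
  qed
  have num: "real (num_draws \<beta> n i) = \<beta> i * real n" if "n \<in> ?T" "i \<in> {1..k}" for n i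
  proof -
    have "\<beta> i * real n \<in> \<nat>" using that by blast
    then show ?thesis by (auto simp: num_draws_def elim!: Nats_cases)
  qed
  have num_ge: "n \<le> num_draws \<beta> n i" if "n \<in> ?T" "i \<in> {1..k}" for n i
  proof -
    have "1 * real n \<le> \<beta> i * real n" using \<beta>_ge_1[OF that(2)] by (intro mult_right_mono) auto
    then show ?thesis using num[OF that] by simp
  qed
  have deviates_prob: "measure (esbm k \<mu> \<beta> n) (deviates n i f) \<le> 2 * q ^ n"
    if n: "n \<in> ?T" "0 < n" and i: "i \<in> {1..k}" and f: "f \<in> test i" for n i f
  proof -
    let ?N = "num_draws \<beta> n i"
    let ?J = "Pair i ` {1..?N}"
    \<comment> \<open>As \<open>\<beta> i \<ge> 1\<close>, every ball has at least \<open>n\<close>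
      draws, which gives one exponential rate for all balls.\<close>
    have N: "n \<le> ?N" using num_ge[OF n(1) i] .
    have "measure (PiM (idx n) (\<lambda>p. \<mu> (fst p))) {\<omega> \<in> space (PiM (idx n) (\<lambda>p. \<mu> (fst p))).
        \<eta> * real (card ?J) \<le> \<bar>(\<Sum>p\<in>?J. f (\<omega> p)) - real (card ?J) * integral\<^sup>L (\<mu> i) f\<bar>}
      \<le> 2 * exp (- (\<eta>\<^sup>2 / (2 * B\<^sup>2)) * real (card ?J))"
    proof (rule prob_average_deviation_le[OF fin_idx prob_idx block[OF i]])
      show "?J \<noteq> {}" using N n(2) by auto
      show "f \<in> borel_measurable (\<mu> i)" by (rule measurable_\<mu>[OF i test_meas[OF f]])
      show "\<bar>f x\<bar> \<le> B" if "x \<in> space (\<mu> i)" for x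
        using test_bound[OF i f] that by (simp add: space_\<mu>[OF i])
    qed (use B(1) \<eta>(1) in auto)
    also have "\<dots> = 2 * q ^ ?N"
      unfolding card_block q_def exp_of_nat_mult[symmetric] by (simp add: mult.commute)
    also have "\<dots> \<le> 2 * q ^ n" using q N by (simp add: power_decreasing)
    finally show ?thesis unfolding deviates_def esbm sum_block card_block by simp
  qed
  define bad where "bad n = (\<Union>(i, f)\<in>(SIGMA i:{1..k}. test i). deviates n i f)" for n
  define L where "L = real (card (SIGMA i:{1..k}. test i))"
  have bad_meas: "bad n \<in> sets (esbm k \<mu> \<beta> n)" for n
    unfolding bad_def using test_fin deviates_meas by (intro sets.finite_UN) auto
  have bad_prob: "measure (esbm k \<mu> \<beta> n) (bad n) \<le> L * (2 * q ^ n)" if "n \<in> ?T" "0 < n" for n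
  proof -
    interpret prob_space "esbm k \<mu> \<beta> n" by (rule prob_esbm)
    have "measure (esbm k \<mu> \<beta> n) (bad n)
      \<le> (\<Sum>p\<in>(SIGMA i:{1..k}. test i). measure (esbm k \<mu> \<beta> n) (case p of (i, f) \<Rightarrow> deviates n i f))"
      unfolding bad_def using test_fin deviates_meas by (intro finite_measure_subadditive_finite) auto
    also have "\<dots> \<le> (\<Sum>p\<in>(SIGMA i:{1..k}. test i). 2 * q ^ n)"
      using deviates_prob[OF that] by (intro sum_mono) auto
    finally show ?thesis by (simp add: L_def)
  qed

  \<comment> \<open>Measurability of the recovery event\<close>
  have A_meas: "?A n \<in> sets (esbm k \<mu> \<beta> n)" for n
  proof -
    have "drawn_points \<beta> n \<omega> = (\<lambda>i. \<omega> ` Pair i ` {1..num_draws \<beta> n i})" for \<omega> :: "nat \<times> nat \<Rightarrow> real ^ 'm"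
      by (rule ext) (simp add: drawn_points_def image_image)
    then show ?thesis
      unfolding esbm using exact_recovery_sets_PiM[where J = "\<lambda>i. Pair i ` {1..num_draws \<beta> n i}", OF _ sets_idx] by simp
  qed

  \<comment> \<open>Almost sure distinctness of points and uniqueness of medians\<close>
  have AE_inj: "AE \<omega> in esbm k \<mu> \<beta> n. inj_on \<omega> (idx n)" for n
  proof -
    have "AE \<omega> in esbm k \<mu> \<beta> n. \<forall>p\<in>idx n. \<forall>p'\<in>idx n. p \<noteq> p' \<longrightarrow> \<omega> p \<noteq> \<omega> p'"
    proof (intro AE_ball_countable[THEN iffD2] ballI countable_finite fin_idx)
      fix p p' assume p: "p \<in> idx n" "p' \<in> idx n"
      show "AE \<omega> in esbm k \<mu> \<beta> n. p \<noteq> p' \<longrightarrow> \<omega> p \<noteq> \<omega> p'"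
      proof (cases "p = p'")
        case False
        have "AE \<omega> in PiM (idx n) (\<lambda>p. \<mu> (fst p)). \<omega> p \<noteq> \<omega> p'"
          using null by (intro AE_PiM_neq[OF fin_idx prob_idx sets_idx _ p False]) (auto simp: idx_def)
        then show ?thesis unfolding esbm by eventually_elim simp
      qed simp
    qed
    then show ?thesis by eventually_elim (auto simp: inj_on_def)
  qed
  \<comment> \<open>For \<open>3 \<le> n\<close> every ball has the three draws that
    \<open>AE_PiM_sum_dist_neq\<close> asks for in dimension at least two. On a line the odd number
    of draws takes over.\<close>
  have AE_unique: "AE \<omega> in esbm k \<mu> \<beta> n. \<forall>i\<in>{1..k}. \<forall>p\<in>drawn_points \<beta> n \<omega> i. \<forall>p'\<in>drawn_points \<beta> n \<omega> i.
      (\<forall>x\<in>drawn_points \<beta> n \<omega> i. (\<Sum>q\<in>drawn_points \<beta> n \<omega> i. dist p q) \<le> (\<Sum>q\<in>drawn_points \<beta> n \<omega> i. dist x q)) \<longrightarrow>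
      (\<forall>x\<in>drawn_points \<beta> n \<omega> i. (\<Sum>q\<in>drawn_points \<beta> n \<omega> i. dist p' q) \<le> (\<Sum>q\<in>drawn_points \<beta> n \<omega> i. dist x q)) \<longrightarrow> p = p'"
    if n: "n \<in> ?T" "3 \<le> n" for n
  proof -
    have inj_block: "inj_on (\<lambda>l. \<omega> (i, l)) {1..num_draws \<beta> n i}"
      if "inj_on \<omega> (idx n)" "i \<in> {1..k}" for i and \<omega> :: "nat \<times> nat \<Rightarrow> real ^ 'm"
    proof (rule inj_onI)
      fix l l' assume "l \<in> {1..num_draws \<beta> n i}" "l' \<in> {1..num_draws \<beta> n i}" "\<omega> (i, l) = \<omega> (i, l')"
      with inj_onD[OF that(1), of "(i, l)" "(i, l')"] that(2) show "l = l'" by (simp add: idx_def)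
    qed
    show ?thesis
    proof (cases "CARD('m) = 1")
      case True
      show ?thesis
        using AE_inj[of n]
      proof (eventually_elim, intro ballI impI)
        fix \<omega> :: "nat \<times> nat \<Rightarrow> real ^ 'm" and i p p'
        let ?X = "drawn_points \<beta> n \<omega> i"
        assume inj: "inj_on \<omega> (idx n)" and i: "i \<in> {1..k}" and p: "p \<in> ?X" "p' \<in> ?X"
          and min: "\<forall>x\<in>?X. (\<Sum>q\<in>?X. dist p q) \<le> (\<Sum>q\<in>?X. dist x q)" "\<forall>x\<in>?X. (\<Sum>q\<in>?X. dist p' q) \<le> (\<Sum>q\<in>?X. dist x q)"
        have "card ?X = num_draws \<beta> n i"
          unfolding drawn_points_def card_image[OF inj_block[OF inj i]] by simp
        then have "odd (card ?X)" using n(1) True i by simp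
        moreover have "finite ?X" by (simp add: drawn_points_def)
        ultimately show "p = p'" using unique_median_vec[OF True _ _ p] min by blast
      qed
    next
      case False
      have dim: "2 \<le> CARD('m)" using False zero_less_card_finite[where 'a = 'm] by linarith
      have "AE \<omega> in esbm k \<mu> \<beta> n. \<forall>p\<in>idx n. \<forall>p'\<in>idx n. fst p = fst p' \<and> p \<noteq> p' \<longrightarrow>
          (\<Sum>l\<in>Pair (fst p) ` {1..num_draws \<beta> n (fst p)}. dist (\<omega> p) (\<omega> l))
          \<noteq> (\<Sum>l\<in>Pair (fst p) ` {1..num_draws \<beta> n (fst p)}. dist (\<omega> p') (\<omega> l))"
      proof (intro AE_ball_countable[THEN iffD2] ballI countable_finite fin_idx)
        fix p p' assume p: "p \<in> idx n" "p' \<in> idx n"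
        let ?J = "Pair (fst p) ` {1..num_draws \<beta> n (fst p)}"
        have i: "fst p \<in> {1..k}" using p(1) by (auto simp: idx_def)
        have "AE \<omega> in PiM (idx n) (\<lambda>p. \<mu> (fst p)). (\<Sum>l\<in>?J. dist (\<omega> p) (\<omega> l)) \<noteq> (\<Sum>l\<in>?J. dist (\<omega> p') (\<omega> l))"
          if "fst p = fst p'" "p \<noteq> p'"
        proof (rule AE_PiM_sum_dist_neq[OF dim fin_idx prob_idx[of _ n] sets_idx[of _ n] _ block[OF i]])
          show "null_on_lebesgue_null (\<mu> (fst p))" if "p \<in> idx n" for p
            using that by (intro null) (auto simp: idx_def)
          show "3 \<le> card ?J" using num_ge[OF n(1) i] n(2) by (simp add: card_block)
          show "p \<in> ?J" using p(1) by (auto simp: idx_def)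
          show "p' \<in> ?J" using p(2) that(1) by (auto simp: idx_def)
        qed (use that in auto)
        then show "AE \<omega> in esbm k \<mu> \<beta> n. fst p = fst p' \<and> p \<noteq> p' \<longrightarrow>
            (\<Sum>l\<in>?J. dist (\<omega> p) (\<omega> l)) \<noteq> (\<Sum>l\<in>?J. dist (\<omega> p') (\<omega> l))"
          unfolding esbm by (cases "fst p = fst p' \<and> p \<noteq> p'") auto
      qed
      with AE_inj[of n] show ?thesis
      proof (eventually_elim, intro ballI impI)
        fix \<omega> :: "nat \<times> nat \<Rightarrow> real ^ 'm" and i p p'
        let ?X = "drawn_points \<beta> n \<omega> i"
        assume inj: "inj_on \<omega> (idx n)" and i: "i \<in> {1..k}" and p: "p \<in> ?X" "p' \<in> ?X"
          and min: "\<forall>x\<in>?X. (\<Sum>q\<in>?X. dist p q) \<le> (\<Sum>q\<in>?X. dist x q)" "\<forall>x\<in>?X. (\<Sum>q\<in>?X. dist p' q) \<le> (\<Sum>q\<in>?X. dist x q)"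
          and neq: "\<forall>p\<in>idx n. \<forall>p'\<in>idx n. fst p = fst p' \<and> p \<noteq> p' \<longrightarrow>
          (\<Sum>l\<in>Pair (fst p) ` {1..num_draws \<beta> n (fst p)}. dist (\<omega> p) (\<omega> l))
          \<noteq> (\<Sum>l\<in>Pair (fst p) ` {1..num_draws \<beta> n (fst p)}. dist (\<omega> p') (\<omega> l))"
        obtain l l' where l: "l \<in> {1..num_draws \<beta> n i}" "p = \<omega> (i, l)"
          and l': "l' \<in> {1..num_draws \<beta> n i}" "p' = \<omega> (i, l')"
          using p by (auto simp: drawn_points_def)
        have sum: "(\<Sum>q\<in>?X. dist x q) = (\<Sum>l\<in>Pair i ` {1..num_draws \<beta> n i}. dist x (\<omega> l))" for x
          unfolding drawn_points_def sum.reindex[OF inj_block[OF inj i]] sum_block by simp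
        have "(\<Sum>q\<in>?X. dist p q) = (\<Sum>q\<in>?X. dist p' q)" using min p by (intro antisym) auto
        then have "(i, l) = (i, l')"
          using neq[rule_format, of "(i, l)" "(i, l')"] l l' i unfolding sum by (auto simp: idx_def)
        then show "p = p'" using l l' by simp
      qed
    qed
  qed

  \<comment> \<open>Recovery outside the deviation events\<close>
  have recovery: "AE \<omega> in esbm k \<mu> \<beta> n. \<omega> \<in> space (esbm k \<mu> \<beta> n) - bad n \<longrightarrow> \<omega> \<in> ?A n"
    if n: "n \<in> ?T" "3 \<le> n" for n
    using AE_inj[of n] AE_unique[OF n]
  proof (eventually_elim, intro impI)
    fix \<omega> :: "nat \<times> nat \<Rightarrow> real ^ 'm"
    assume inj: "inj_on \<omega> (idx n)" and \<omega>: "\<omega> \<in> space (esbm k \<mu> \<beta> n) - bad n"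
      and uniq: "\<forall>i\<in>{1..k}. \<forall>p\<in>drawn_points \<beta> n \<omega> i. \<forall>p'\<in>drawn_points \<beta> n \<omega> i.
      (\<forall>x\<in>drawn_points \<beta> n \<omega> i. (\<Sum>q\<in>drawn_points \<beta> n \<omega> i. dist p q) \<le> (\<Sum>q\<in>drawn_points \<beta> n \<omega> i. dist x q)) \<longrightarrow>
      (\<forall>x\<in>drawn_points \<beta> n \<omega> i. (\<Sum>q\<in>drawn_points \<beta> n \<omega> i. dist p' q) \<le> (\<Sum>q\<in>drawn_points \<beta> n \<omega> i. dist x q)) \<longrightarrow> p = p'"
    have good: "\<bar>(\<Sum>l\<in>{1..num_draws \<beta> n i}. f (\<omega> (i, l))) - real (num_draws \<beta> n i) * integral\<^sup>L (\<mu> i) f\<bar>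
        < \<eta> * real (num_draws \<beta> n i)" if "i \<in> {1..k}" "f \<in> test i" for i f
    proof -
      have "\<omega> \<notin> deviates n i f" using \<omega> that by (auto simp: bad_def)
      then show ?thesis using \<omega> by (simp add: deviates_def not_le)
    qed
    have near: "\<exists>w\<in>W. dist z w \<le> \<tau> / 3" if "j \<in> {1..k}" "z \<in> cball (c j) (r j)" for j z
    proof -
      have "z \<in> K" using that unfolding K_def by blast
      then obtain w where "w \<in> W" "z \<in> ball w (\<tau> / 3)" using W(2) by blast
      then show ?thesis by (intro bexI[of _ w]) (auto simp: dist_commute)
    qed
    have "exact_recovery k (drawn_points \<beta> n \<omega>)"
    proof (rule exact_recovery_if_concentrated[OF _ num[OF n(1)] \<epsilon> \<theta>(2) \<tau>(2) \<tau>b])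
      show "0 < n" using n(2) by simp
      show "\<omega> (i, l) \<in> cball (c i) (r i)" if "i \<in> {1..k}" "l \<in> {1..num_draws \<beta> n i}" for i l
      proof -
        have "(i, l) \<in> idx n" using that by (simp add: idx_def)
        then have "\<omega> (i, l) \<in> space (\<mu> i)" using \<omega> unfolding esbm by (auto simp: space_PiM PiE_iff)
        then show ?thesis by (simp add: space_\<mu>[OF that(1)])
      qed
      show "inj_on \<omega> (SIGMA i:{1..k}. {1..num_draws \<beta> n i})" using inj by (simp only: idx_def)
    next
      fix i j z assume i: "i \<in> {1..k}" and j: "j \<in> {1..k}" "z \<in> cball (c j) (r j)"
      let ?N = "num_draws \<beta> n i"
      obtain w where w: "w \<in> W" "dist z w \<le> \<tau> / 3" using near[OF j] by blast
      have t: "dist w \<in> test i" "(\<lambda>x. max (\<alpha> i - dist w x) 0) \<in> test i" using w(1) by (auto simp: test_def)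
      have \<eta>N: "\<eta> * real ?N \<le> \<tau> / 3 * real ?N" using \<eta>(2) by (intro mult_right_mono) auto
      have "\<bar>(\<Sum>l\<in>{1..?N}. dist z (\<omega> (i, l))) - real (card {1..?N}) * mean_dist i z\<bar>
          \<le> 3 * (\<tau> / 3) * real (card {1..?N})"
      proof (rule average_close_if_close_at_neighbour[where w = w and h = dist and H = "mean_dist i" and X = "\<lambda>l. \<omega> (i, l)"])
        show "\<bar>dist z x - dist w x\<bar> \<le> \<tau> / 3" for x
          using abs_dist_diff_le[of z x w] w(2) unfolding dist_commute[of x w] by linarith
        show "\<bar>mean_dist i z - mean_dist i w\<bar> \<le> \<tau> / 3" using mean_dist_lipschitz[OF i, of z w] w(2) by linarith
        show "\<bar>(\<Sum>l\<in>{1..?N}. dist w (\<omega> (i, l))) - real (card {1..?N}) * mean_dist i w\<bar> \<le> \<tau> / 3 * real (card {1..?N})"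
          using good[OF i t(1)] \<eta>N by simp
      qed
      then show "\<bar>(\<Sum>l\<in>{1..?N}. dist z (\<omega> (i, l))) - real ?N * mean_dist i z\<bar> \<le> \<tau> * real ?N" by simp
      have "\<bar>(\<Sum>l\<in>{1..?N}. max (\<alpha> i - dist z (\<omega> (i, l))) 0) - real (card {1..?N}) * mean_hinge i z\<bar>
          \<le> 3 * (\<tau> / 3) * real (card {1..?N})"
      proof (rule average_close_if_close_at_neighbour[where w = w and h = "\<lambda>z x. max (\<alpha> i - dist z x) 0"
            and H = "mean_hinge i" and X = "\<lambda>l. \<omega> (i, l)"])
        show "\<bar>max (\<alpha> i - dist z x) 0 - max (\<alpha> i - dist w x) 0\<bar> \<le> \<tau> / 3" for x
          using abs_dist_diff_le[of z x w] w(2) unfolding dist_commute[of x w] by linarith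
        show "\<bar>mean_hinge i z - mean_hinge i w\<bar> \<le> \<tau> / 3" using mean_hinge_lipschitz[OF i, of z w] w(2) by linarith
        show "\<bar>(\<Sum>l\<in>{1..?N}. max (\<alpha> i - dist w (\<omega> (i, l))) 0) - real (card {1..?N}) * mean_hinge i w\<bar>
            \<le> \<tau> / 3 * real (card {1..?N})"
          using good[OF i t(2)] \<eta>N by simp
      qed
      then show "\<bar>(\<Sum>l\<in>{1..?N}. max (\<alpha> i - dist z (\<omega> (i, l))) 0) - real ?N * mean_hinge i z\<bar> \<le> \<tau> * real ?N" by simp
    next
      fix i assume i: "i \<in> {1..k}"
      let ?N = "num_draws \<beta> n i"
      have N: "0 < real ?N" using num_ge[OF n(1) i] n(2) by simp
      show "\<exists>l\<in>{1..?N}. dist (\<omega> (i, l)) (c i) \<le> \<tau>"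
      proof (rule ccontr)
        assume "\<not> ?thesis"
        \<comment> \<open>Without a draw near the center, the empirical mean of the indicator would
          be 0 and miss its expectation \<open>mass i\<close> by more than
          \<open>\<eta>\<close>.\<close>
        then have "(\<Sum>l\<in>{1..?N}. indicator (ball (c i) \<tau>) (\<omega> (i, l)) :: real) = 0"
          by (intro sum.neutral) (auto simp: indicator_def dist_commute)
        then have "real ?N * mass i < \<eta> * real ?N"
          using good[OF i, of "indicator (ball (c i) \<tau>)"] mass[OF i] by (simp add: test_def mass_def)
        then show False using \<eta>_mass[OF i] N by simp
      qed
    next
      fix i p p' assume "i \<in> {1..k}" "p \<in> drawn_points \<beta> n \<omega> i" "p' \<in> drawn_points \<beta> n \<omega> i"
        "\<And>x. x \<in> drawn_points \<beta> n \<omega> i \<Longrightarrow> (\<Sum>q\<in>drawn_points \<beta> n \<omega> i. dist p q) \<le> (\<Sum>q\<in>drawn_points \<beta> n \<omega> i. dist x q)"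
        "\<And>x. x \<in> drawn_points \<beta> n \<omega> i \<Longrightarrow> (\<Sum>q\<in>drawn_points \<beta> n \<omega> i. dist p' q) \<le> (\<Sum>q\<in>drawn_points \<beta> n \<omega> i. dist x q)"
      then show "p = p'" using uniq by blast
    qed
    then show "\<omega> \<in> ?A n" using \<omega> by simp
  qed

  \<comment> \<open>Convergence of the probabilities\<close>
  show ?thesis
    unfolding with_high_probability_def
  proof (intro allI impI)
    fix \<delta> :: real assume \<delta>: "0 < \<delta> \<and> \<delta> < 1"
    have "(\<lambda>n. L * (2 * q ^ n)) \<longlonglongrightarrow> L * (2 * 0)"
      using q by (intro tendsto_intros LIMSEQ_power_zero) auto
    then have "\<forall>\<^sub>F n in sequentially. L * (2 * q ^ n) < \<delta>"
      using \<delta> by (intro order_tendstoD) auto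
    then obtain N0 where N0: "\<And>n. N0 \<le> n \<Longrightarrow> L * (2 * q ^ n) < \<delta>"
      unfolding eventually_sequentially by blast
    show "\<exists>N>0. \<forall>n\<in>?T. N < n \<longrightarrow> 1 - \<delta> < measure (esbm k \<mu> \<beta> n) (?A n)"
    proof (intro exI[of _ "max N0 3"] conjI ballI impI)
      fix n assume n: "n \<in> ?T" "max N0 3 < n"
      interpret prob_space "esbm k \<mu> \<beta> n" by (rule prob_esbm)
      have "1 - \<delta> < 1 - prob (bad n)"
        using bad_prob[OF n(1)] N0[of n] n(2) by fastforce
      also have "\<dots> = prob (space (esbm k \<mu> \<beta> n) - bad n)"
        using bad_meas by (simp add: prob_compl)
      \<comment> \<open>The inclusion holds only almost everywhere: coinciding points and ties cost
        nothing, but \<open>?A n\<close> must be measurable.\<close>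
      also have "\<dots> \<le> prob (?A n)"
        using recovery[OF n(1)] A_meas n(2) by (intro finite_measure_mono_AE) auto
      finally show "1 - \<delta> < measure (esbm k \<mu> \<beta> n) (?A n)" .
    qed simp
  qed
qed

end

theorem theorem2:
  fixes k :: nat
    and c :: "nat \<Rightarrow> real ^ 'm"
    and r \<beta> E \<alpha> :: "nat \<Rightarrow> real"
    and \<mu> :: "nat \<Rightarrow> (real ^ 'm) measure"
    and \<gamma> :: real
  assumes "1 \<le> k"
    and "\<And>i. i \<in> {1..k} \<Longrightarrow> 0 < r i"
    and "\<And>i. i \<in> {1..k} \<Longrightarrow> 1 \<le> \<beta> i"
    and "\<And>i. i \<in> {1..k} \<Longrightarrow> prob_space (\<mu> i)"
    and "\<And>i. i \<in> {1..k} \<Longrightarrow> sets (\<mu> i) = sets (restrict_space borel (cball (c i) (r i)))"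
    and "\<And>i. i \<in> {1..k} \<Longrightarrow> rotation_invariant (\<mu> i) (c i)"
    and "\<And>i. i \<in> {1..k} \<Longrightarrow> positive_near_center (\<mu> i) (c i) (r i)"
    and "\<And>i. i \<in> {1..k} \<Longrightarrow> null_on_lebesgue_null (\<mu> i)"
    and "\<And>i. i \<in> {1..k} \<Longrightarrow> E i = (\<integral>x. dist x (c i) \<partial>\<mu> i)"
    and "(MAX i\<in>{1..k}. \<beta> i * (r i - E i)) < \<gamma>"
    and "ereal \<gamma> < (MIN i\<in>{1..k}. ereal (\<beta> i) * (ball_gap k c r i - ereal (E i)))"
    and "\<And>i. i \<in> {1..k} \<Longrightarrow> \<alpha> i = E i + \<gamma> / \<beta> i"
    and "\<And>i z. i \<in> {1..k} \<Longrightarrow>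
           is_arg_max (mean_contribution k \<mu> \<beta> \<alpha>) (\<lambda>w. w \<in> cball (c i) (r i)) z \<longleftrightarrow> z = c i"
  shows "with_high_probability
    {n. (\<forall>i\<in>{1..k}. \<beta> i * real n \<in> \<nat>) \<and>
        (CARD('m) = 1 \<longrightarrow> (\<forall>i\<in>{1..k}. odd (num_draws \<beta> n i)))}
    (\<lambda>n. esbm k \<mu> \<beta> n)
    (\<lambda>n. {\<omega> \<in> space (esbm k \<mu> \<beta> n). exact_recovery k (drawn_points \<beta> n \<omega>)})"
proof -
  have \<beta>_pos: "0 < \<beta> i" if "i \<in> {1..k}" for i using assms(3)[OF that] by simp
  interpret separated_balls k c r \<beta> \<alpha> \<mu> \<gamma>
  proof (rule separated_balls.intro)
    fix i assume i: "i \<in> {1..k}"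
    have "\<beta> i * (r i - E i) \<le> (MAX i\<in>{1..k}. \<beta> i * (r i - E i))" using i by (intro Max_ge) auto
    also note assms(10)
    finally show "r i < \<alpha> i" using \<beta>_pos[OF i] by (simp add: assms(12)[OF i] field_simps)
    show "\<gamma> = \<beta> i * (\<alpha> i - (\<integral>x. dist (c i) x \<partial>\<mu> i))"
      using \<beta>_pos[OF i] by (simp add: assms(9)[OF i] assms(12)[OF i] dist_commute)
  next
    fix i j assume i: "i \<in> {1..k}" and j: "j \<in> {1..k}" and "i \<noteq> j"
    have "ereal \<gamma> < (MIN i\<in>{1..k}. ereal (\<beta> i) * (ball_gap k c r i - ereal (E i)))" by (rule assms(11))
    also have "\<dots> \<le> ereal (\<beta> j) * (ball_gap k c r j - ereal (E j))" using j by (intro Min_le) auto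
    \<comment> \<open>Bounding the infimum by its member for ball \<open>i\<close> leaves only
      finite terms, so the inequality becomes one between reals.\<close>
    also have "\<dots> \<le> ereal (\<beta> j) * (ereal (dist (c j) (c i) - r j) - ereal (E j))"
    proof (intro ereal_mult_left_mono ereal_minus_mono order_refl)
      show "ball_gap k c r j \<le> ereal (dist (c j) (c i) - r j)"
        unfolding ball_gap_def using i \<open>i \<noteq> j\<close> by (intro INF_lower) auto
    qed (use \<beta>_pos[OF j] in simp)
    finally have "\<gamma> < \<beta> j * (dist (c j) (c i) - r j - E j)" by simp
    then show "\<alpha> j < dist (c i) (c j) - r j"
      using \<beta>_pos[OF j] by (simp add: assms(12)[OF j] field_simps dist_commute)
  qed (fact assms(2) assms(3) assms(4) assms(5))+
  interpret center_optimal k c r \<beta> \<alpha> \<mu> \<gamma>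
  proof
    fix i z assume i: "i \<in> {1..k}" and z: "z \<in> cball (c i) (r i)" "z \<noteq> c i"
    let ?G = "mean_contribution k \<mu> \<beta> \<alpha>"
    have "is_arg_max ?G (\<lambda>w. w \<in> cball (c i) (r i)) (c i)" using assms(13)[OF i] by simp
    then have max: "?G y \<le> ?G (c i)" if "y \<in> cball (c i) (r i)" for y
      using that by (auto simp: is_arg_max_linorder)
    \<comment> \<open>A point of the ball that is not a maximizer is beaten strictly by some
      \<open>y\<close>, which in turn does not exceed the center.\<close>
    have "\<not> is_arg_max ?G (\<lambda>w. w \<in> cball (c i) (r i)) z" using assms(13)[OF i] z(2) by simp
    then obtain y where "y \<in> cball (c i) (r i)" "?G z < ?G y" using z(1) by (auto simp: is_arg_max_def)
    then show "?G z < \<gamma>" using max[of y] mean_contribution_center[OF i] by simp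
  qed
  show ?thesis by (rule exact_recovery_with_high_probability[OF assms(8) assms(7)])
qed

end
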